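(* Let $V$ be an $n$-dimensional vector space over the finite field $\mathbb{F}_q$ with $q$ elements. Let $\mathcal{P}$ be the set of $1$-dimensional subspaces of $V$, and let $f:\mathcal{P}\to\mathbb{R}$ be a function with $\sum_{P\in\mathcal{P}} f(P)=0$. Let $k$ and $x$ be integers with $2\le x\le k$. Suppose that at least one of the following conditions is satisfied: (a) $(x-1)n\ge (2x-1)k-x+2$, $n\ge 2k+2$, and $q\ge (x-1)!\cdot 2^{x+2}$; (b) $(x-1)n\ge (2x-1)k-x+1$, $n\ge 2k+1$, and $q\ge (x-1)!\cdot 2^{2x+1}$; (c) $n\ge 3k$ and $q\ge 2$, or $n=k$ and $q\ge 2$. Then there are at least $\genfrac{[}{]}{0pt}{}{n-1}{k-1}$ $k$-dimensional subspaces of $V$ with nonnegative weight. Moreover, if equality holds (i.e. there are exactly $\genfrac{[}{]}{0pt}{}{n-1}{k-1}$ $k$-dimensional subspaces with nonnegative weight) and $n\ge 2k+1$, then the set of $k$-dimensional subspaces with nonnegative weight is the set of all $k$-dimensional subspaces containing some fixed $1$-dimensional subspace.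
   Context: The weight of a subspace $S$ of $V$ is $\sum_{P\in\mathcal{P},\,P\subseteq S} f(P)$. The Gaussian coefficient (with respect to the fixed $q$) is $\genfrac{[}{]}{0pt}{}{n}{k}=\prod_{i=1}^{k}\frac{q^{n-i+1}-1}{q^i-1}$ if $0\le k\le n$, and $0$ otherwise. *)

theory Defs
  imports Complex_Main
begin

definition gaussian_coeff :: "nat \<Rightarrow> nat \<Rightarrow> nat \<Rightarrow> real" where
  "gaussian_coeff q n k =
    (if k \<le> n then \<Prod>i = 1..k. (real q ^ (n - i + 1) - 1) / (real q ^ i - 1) else 0)"

definition subspaces_of_dim ::
    "('a::field \<Rightarrow> 'b::ab_group_add \<Rightarrow> 'b) \<Rightarrow> nat \<Rightarrow> 'b set set" where
  "subspaces_of_dim scale k = {S. module.subspace scale S \<and> vector_space.dim scale S = k}"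

(* f is total on 'b set, but only its values on 1-dimensional subspaces are used. *)
definition weight ::
    "('a::field \<Rightarrow> 'b::ab_group_add \<Rightarrow> 'b) \<Rightarrow> ('b set \<Rightarrow> real) \<Rightarrow> 'b set \<Rightarrow> real" where
  "weight scale f S = (\<Sum>P | P \<in> subspaces_of_dim scale 1 \<and> P \<subseteq> S. f P)"

definition nonneg_subspaces ::
    "('a::field \<Rightarrow> 'b::ab_group_add \<Rightarrow> 'b) \<Rightarrow> ('b set \<Rightarrow> real) \<Rightarrow> nat \<Rightarrow> 'b set set" where
  "nonneg_subspaces scale f k = {S \<in> subspaces_of_dim scale k. 0 \<le> weight scale f S}"

end

theory Submission
  imports Defs "HOL-Analysis.Convex"
begin

text \<open>
  Let \<open>Y\<close> be the set of \<open>k\<close>-spaces of nonnegative weight and \<open>M\<close> the number of \<open>k\<close>-spaces through a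
  point, and scale \<open>f\<close> so that the maximal weight of a \<open>k\<close>-space is \<open>1\<close>, attained at \<open>S\<close>. Suppose that
  \<open>Y\<close> has at most \<open>M\<close> elements and contains no full star.

  The \<open>k\<close>-spaces meeting a given \<open>k\<close>-space \<open>U\<close> have total weight \<open>L\<close> times that of \<open>U\<close>, where \<open>L\<close> is
  close to \<open>M\<close>. Applied to \<open>U = S\<close> this shows that almost all of \<open>Y\<close> meets \<open>S\<close> and has weight close to
  \<open>1\<close>. Applied to general \<open>U\<close> it bounds the weights from below, so the sum of all \<open>f(P)\<^sup>2\<close> is at most
  about \<open>2\<close>. By a second moment computation the weights of the \<open>k\<close>-spaces through a point \<open>P\<close> are then
  concentrated around \<open>f(P)\<close>.

  Every point \<open>P\<close> lies in a \<open>k\<close>-space of negative weight, hence in an \<open>(n - k)\<close>-space \<open>W\<close> of negative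
  weight. Comparison with a complement of \<open>W\<close> of largest weight shows that a fixed fraction of \<open>M\<close>
  elements of \<open>Y\<close> are complements of \<open>W\<close> and so avoid \<open>P\<close>. Thus the nonnegative \<open>k\<close>-spaces through \<open>P\<close>
  are a proper fraction of all \<open>k\<close>-spaces through \<open>P\<close>. By concentration they then contribute little to
  the sum of squared weights, so the points of \<open>S\<close> together cannot account for almost all of \<open>Y\<close>.
\<close>

subsection \<open>Counting subspaces over a finite field\<close>

locale finite_field_vector_space = finite_dimensional_vector_space scale Basis
  for scale :: "'a::{field,finite} \<Rightarrow> 'b::ab_group_add \<Rightarrow> 'b" (infixr "*s" 75)
    and Basis :: "'b set" +
  fixes q :: real
  assumes q_eq: "q = real (card (UNIV :: 'a set))"
begin

text \<open>Trivial intersection is expressed as \<open>dim (A \<inter> B) = 0\<close> throughout;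
  as a simp rule this would turn such equations into statements about sets and block the dimension
  arithmetic.\<close>

declare dim_eq_0 [simp del]

definition points :: "'b set \<Rightarrow> 'b set set" where
  "points A = {P \<in> subspaces_of_dim scale 1. P \<subseteq> A}"

text \<open>The q-number of \<open>d\<close>, that is, the number of points of a
  \<open>d\<close>-dimensional space (\<open>card_points\<close>).\<close>

definition br :: "nat \<Rightarrow> real" where
  "br d = (q ^ d - 1) / (q - 1)"

definition join :: "'b set \<Rightarrow> 'b set \<Rightarrow> 'b set" where
  "join A B = span (A \<union> B)"

section \<open>Cardinality of a subspace\<close>

lemma two_le_card_field: "2 \<le> card (UNIV :: 'a set)"
proof -
  have "card {0::'a, 1} \<le> card (UNIV :: 'a set)" by (rule card_mono) auto
  then show ?thesis by simp
qed

lemma q_ge_2: "q \<ge> 2"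
  using two_le_card_field by (simp add: q_eq)

lemma card_span_independent:
  assumes "finite B" "independent B"
  shows "card (span B) = card (UNIV :: 'a set) ^ card B"
  using assms
proof (induction B rule: finite_induct)
  case empty
  then show ?case by simp
next
  case (insert b B)
  have ind: "independent B" and b: "b \<notin> span B"
    using insert by (auto simp: independent_insert)
  have "bij_betw (\<lambda>(c, y). c *s b + y) (UNIV \<times> span B) (span (insert b B))"
  proof (rule bij_betw_imageI)
    show "inj_on (\<lambda>(c, y). c *s b + y) (UNIV \<times> span B)"
    proof (rule inj_onI, clarify)
      fix c y c' y' assume y: "y \<in> span B" "y' \<in> span B" and eq: "c *s b + y = c' *s b + y'"
      have "(c - c') *s b = y' - y" using eq by (simp add: scale_left_diff_distrib algebra_simps)
      then have "(c - c') *s b \<in> span B" using y by (simp add: span_diff)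
      then have "c = c'" using b
        by (metis eq_iff_diff_eq_0 scale_scale span_scale left_inverse scale_one)
      then show "c = c' \<and> y = y'" using eq by simp
    qed
    show "(\<lambda>(c, y). c *s b + y) ` (UNIV \<times> span B) = span (insert b B)"
    proof (intro set_eqI iffI)
      fix x assume "x \<in> (\<lambda>(c, y). c *s b + y) ` (UNIV \<times> span B)"
      then show "x \<in> span (insert b B)"
        by (auto intro!: span_add intro: span_scale span_base span_mono[THEN subsetD])
    next
      fix x assume "x \<in> span (insert b B)"
      then obtain c where "x - c *s b \<in> span B" by (auto simp: span_insert)
      then show "x \<in> (\<lambda>(c, y). c *s b + y) ` (UNIV \<times> span B)"
        by (intro image_eqI[of _ _ "(c, x - c *s b)"]) auto
    qed
  qed
  then have "card (span (insert b B)) = card (UNIV \<times> span B :: ('a \<times> 'b) set)"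
    by (simp add: bij_betw_same_card)
  then show ?case using insert ind by (simp add: card_cartesian_product)
qed

lemma card_subspace:
  assumes "subspace S"
  shows "card S = card (UNIV :: 'a set) ^ dim S"
proof -
  obtain B where B: "B \<subseteq> S" "independent B" "S \<subseteq> span B" "card B = dim S"
    using basis_exists by blast
  have "span B = S" using B assms by (simp add: span_subspace)
  then show ?thesis using card_span_independent[of B] B finiteI_independent by auto
qed

lemma finite_UNIV_space: "finite (UNIV :: 'b set)"
proof (rule card_ge_0_finite)
  show "0 < card (UNIV :: 'b set)" using card_subspace[OF subspace_UNIV] two_le_card_field by simp
qed

lemma finite_space [simp]: "finite (A :: 'b set)"
  by (rule finite_subset[OF subset_UNIV finite_UNIV_space])

lemma finite_space_sets [simp]: "finite (X :: 'b set set)"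
  by (rule finite_subset[of _ "Pow UNIV"]) (auto simp del: Pow_UNIV)

lemma subspaces_of_dimD:
  assumes "S \<in> subspaces_of_dim scale d"
  shows "subspace S" "dim S = d"
  using assms by (auto simp: subspaces_of_dim_def)

section \<open>Joins of subspaces and numbers of points\<close>

lemma join_subset_iff: "subspace C \<Longrightarrow> join A B \<subseteq> C \<longleftrightarrow> A \<subseteq> C \<and> B \<subseteq> C"
  unfolding join_def using span_minimal[of "A \<union> B" C] span_superset[of "A \<union> B"] by blast

lemma subspace_join [simp]: "subspace (join A B)"
  by (simp add: join_def)

lemma join_upper: "A \<subseteq> join A B" "B \<subseteq> join A B"
  using span_superset[of "A \<union> B"] by (auto simp: join_def)

lemma dim_join:
  assumes "subspace A" "subspace B"
  shows "dim (join A B) + dim (A \<inter> B) = dim A + dim B"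
proof -
  have "join A B = {x + y |x y. x \<in> A \<and> y \<in> B}"
    using assms by (simp add: join_def span_Un span_eq_iff[THEN iffD2])
  then show ?thesis using dim_sums_Int[OF assms] by simp
qed

lemma point_Int:
  assumes "P \<in> subspaces_of_dim scale 1" "subspace J" "\<not> P \<subseteq> J"
  shows "dim (J \<inter> P) = 0"
proof -
  note P = subspaces_of_dimD[OF assms(1)]
  have "dim (J \<inter> P) \<le> 1" using dim_subset[of "J \<inter> P" P] P by auto
  moreover have "dim (J \<inter> P) \<noteq> 1"
  proof
    assume "dim (J \<inter> P) = 1"
    then have "J \<inter> P = P"
      using P assms(2) by (intro subspace_dim_equal) (auto simp: subspace_inter)
    then show False using assms(3) by auto
  qed
  ultimately show ?thesis by linarith
qed

lemma dim_join_point: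
  assumes "P \<in> subspaces_of_dim scale 1" "subspace J"
  shows "dim (join J P) = (if P \<subseteq> J then dim J else dim J + 1)"
proof (cases "P \<subseteq> J")
  case True
  then have "join J P = J" using assms(2) by (simp add: join_def Un_absorb2)
  then show ?thesis using True by simp
next
  case False
  then show ?thesis
    using dim_join[OF assms(2), of P] point_Int[OF assms False] subspaces_of_dimD[OF assms(1)] by simp
qed

text \<open>The points of \<open>S\<close> partition its nonzero vectors into classes of size
  \<open>q - 1\<close>.\<close>

lemma card_points:
  assumes "subspace S"
  shows "real (card (points S)) = br (dim S)"
proof -
  have pt: "subspace P" "dim P = 1" "P \<subseteq> S" "card P = card (UNIV :: 'a set)" if "P \<in> points S" for P
    using that card_subspace[of P] by (auto simp: points_def subspaces_of_dim_def)
  have eq: "S - {0} = (\<Union>P\<in>points S. P - {0})"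
  proof (intro set_eqI iffI)
    fix v assume v: "v \<in> S - {0}"
    have "span {v} \<subseteq> S" using v assms by (intro span_minimal) auto
    then have "span {v} \<in> points S" using v by (simp add: points_def subspaces_of_dim_def)
    moreover have "v \<in> span {v}" by (simp add: span_base)
    ultimately show "v \<in> (\<Union>P\<in>points S. P - {0})" using v by blast
  qed (use pt in auto)
  have disj: "(P - {0}) \<inter> (P' - {0}) = {}" if "P \<in> points S" "P' \<in> points S" "P \<noteq> P'" for P P'
  proof -
    have "\<not> P \<subseteq> P'" using subspace_dim_equal[of P P'] pt that by auto
    then have "dim (P' \<inter> P) = 0"
      using that point_Int[of P P'] pt[OF that(2)] by (auto simp: points_def)
    then show ?thesis by (auto simp: dim_eq_0)
  qed
  have "card (S - {0}) = (\<Sum>P\<in>points S. card (P - {0}))"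
    unfolding eq using disj by (intro card_UN_disjoint) auto
  also have "\<dots> = (\<Sum>P\<in>points S. card (UNIV :: 'a set) - 1)"
    using pt by (intro sum.cong) (auto simp: card_Diff_singleton subspace_0)
  finally have "card S - 1 = card (points S) * (card (UNIV :: 'a set) - 1)"
    using subspace_0[OF assms] by (simp add: card_Diff_singleton)
  then have "q ^ dim S - 1 = real (card (points S)) * (q - 1)"
    using card_subspace[OF assms] two_le_card_field unfolding q_eq
    by (metis (no_types, lifting) of_nat_1 of_nat_diff of_nat_mult of_nat_power one_le_numeral one_le_power order_trans)
  then show ?thesis using q_ge_2 by (simp add: br_def field_simps)
qed

lemma br_0 [simp]: "br 0 = 0" and br_1 [simp]: "br (Suc 0) = 1" and br_2: "br 2 = q + 1"
  using q_ge_2 by (auto simp: br_def power2_eq_square field_simps)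

lemma br_mono: "i \<le> j \<Longrightarrow> br i \<le> br j"
  using q_ge_2 by (simp add: br_def divide_right_mono power_increasing)

lemma br_strict_mono: "i < j \<Longrightarrow> br i < br j"
  using q_ge_2 by (simp add: br_def divide_strict_right_mono power_strict_increasing)

lemma br_nonneg: "0 \<le> br i"
  using br_mono[of 0 i] by simp

lemma br_diff: "br i - br j = (q ^ i - q ^ j) / (q - 1)"
  by (simp add: br_def diff_divide_distrib)

lemma card_points_diff:
  assumes "subspace A" "subspace B" "B \<subseteq> A"
  shows "real (card {Q \<in> points A. \<not> Q \<subseteq> B}) = br (dim A) - br (dim B)"
proof -
  have "{Q \<in> points A. \<not> Q \<subseteq> B} = points A - points B" by (auto simp: points_def)
  moreover have "points B \<subseteq> points A" using assms by (auto simp: points_def)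
  ultimately show ?thesis
    using card_points[OF assms(1)] card_points[OF assms(2)] card_mono[of "points A" "points B"]
    by (simp add: card_Diff_subset of_nat_diff)
qed

text \<open>Double counting of the pairs of a good extension \<open>T\<close> of \<open>J\<close> and a point of \<open>T\<close> outside
  \<open>J\<close> reduces the count for \<open>J\<close> to that for the joins of \<open>J\<close> with a point.\<close>

lemma card_good_extensions:
  fixes good :: "'b set \<Rightarrow> bool" and r :: "nat \<Rightarrow> real"
  assumes down: "\<And>T J. good T \<Longrightarrow> J \<subseteq> T \<Longrightarrow> good J"
    and r: "\<And>J. subspace J \<Longrightarrow> good J \<Longrightarrow> dim J < k \<Longrightarrow>
      real (card {Q \<in> points UNIV. \<not> Q \<subseteq> J \<and> good (join J Q)}) = r (dim J)"
    and J: "subspace J" "good J" "dim J \<le> k"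
  shows "real (card {T \<in> subspaces_of_dim scale k. J \<subseteq> T \<and> good T})
    = (\<Prod>i=dim J..<k. r i / (br k - br i))"
  using J
proof (induction "k - dim J" arbitrary: J)
  case 0
  then have dJ: "dim J = k" by simp
  have "T = J" if "T \<in> subspaces_of_dim scale k" "J \<subseteq> T" for T
    using that 0 dJ subspaces_of_dimD[OF that(1)] by (metis order_refl subspace_dim_equal)
  then have "{T \<in> subspaces_of_dim scale k. J \<subseteq> T \<and> good T} = {J}"
    using 0 dJ by (auto simp: subspaces_of_dim_def)
  then show ?case using dJ by simp
next
  case (Suc x)
  then have lt: "dim J < k" by simp
  define E where "E = {T \<in> subspaces_of_dim scale k. J \<subseteq> T \<and> good T}"
  define R where "R = {Q \<in> points UNIV. \<not> Q \<subseteq> J \<and> good (join J Q)}"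
  define c where "c = (\<Prod>i=Suc (dim J)..<k. r i / (br k - br i))"
  have inner1: "real (card {Q \<in> R. Q \<subseteq> T}) = br k - br (dim J)" if "T \<in> E" for T
  proof -
    have T: "subspace T" "dim T = k" "J \<subseteq> T" "good T"
      using that by (auto simp: E_def subspaces_of_dim_def)
    \<comment> \<open>A point of \<open>T\<close> outside \<open>J\<close> belongs to
      \<open>R\<close> automatically: its join with \<open>J\<close> lies in the good space
      \<open>T\<close>, so \<open>down\<close> applies.\<close>
    have "{Q \<in> R. Q \<subseteq> T} = {Q \<in> points T. \<not> Q \<subseteq> J}"
      using T down[of T] by (auto simp: R_def points_def join_subset_iff)
    then show ?thesis using card_points_diff[OF T(1) Suc.prems(1) T(3)] T by simp
  qed
  have inner2: "real (card {T \<in> E. Q \<subseteq> T}) = c" if "Q \<in> R" for Q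
  proof -
    have Q: "Q \<in> subspaces_of_dim scale 1" "\<not> Q \<subseteq> J" "good (join J Q)"
      using that by (auto simp: R_def points_def)
    have d: "dim (join J Q) = Suc (dim J)" using dim_join_point[OF Q(1) Suc.prems(1)] Q by simp
    have "join J Q \<subseteq> T \<longleftrightarrow> J \<subseteq> T \<and> Q \<subseteq> T" if "T \<in> subspaces_of_dim scale k" for T
      using that by (simp add: join_subset_iff subspaces_of_dimD(1))
    then have "{T \<in> E. Q \<subseteq> T} = {T \<in> subspaces_of_dim scale k. join J Q \<subseteq> T \<and> good T}"
      by (auto simp: E_def)
    then show ?thesis
      using Suc.hyps(1)[of "join J Q"] Suc.hyps(2) Q d lt by (simp add: c_def)
  qed
  have "(\<Sum>T\<in>E. real (card {Q \<in> R. Q \<subseteq> T})) = (\<Sum>Q\<in>R. real (card {T \<in> E. Q \<subseteq> T}))"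
    using sum.swap_restrict[of E R "\<lambda>_ _. 1::real" "\<lambda>T Q. Q \<subseteq> T"] by simp
  then have "real (card E) * (br k - br (dim J)) = real (card R) * c"
    using inner1 inner2 by simp
  moreover have "real (card R) = r (dim J)" using r[OF Suc.prems(1,2) lt] by (simp add: R_def)
  moreover have "br k - br (dim J) > 0" using br_strict_mono[OF lt] by simp
  ultimately have "real (card E) = r (dim J) / (br k - br (dim J)) * c" by (simp add: field_simps)
  then show ?case using lt by (simp add: E_def c_def prod.atLeast_Suc_lessThan)
qed

text \<open>Both sides say that \<open>J\<close>, \<open>Q\<close> and \<open>S\<close> together
  span one dimension more than \<open>J\<close> and \<open>S\<close>; this follows by computing the
  dimension of their common join in two ways.\<close>

lemma join_point_disjoint_iff:
  assumes Q: "Q \<in> subspaces_of_dim scale 1"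
    and J: "subspace J" and S: "subspace S" and disj: "dim (J \<inter> S) = 0"
  shows "\<not> Q \<subseteq> J \<and> dim (join J Q \<inter> S) = 0 \<longleftrightarrow> \<not> Q \<subseteq> join J S"
proof -
  have dJS: "dim (join J S) = dim S + dim J" using dim_join[OF J S] disj by simp
  have eq: "join (join J Q) S = join (join J S) Q"
    by (intro antisym) (use join_upper in \<open>simp add: join_subset_iff, blast\<close>)+
  have "dim (join (join J S) Q) + dim (join J Q \<inter> S) = dim (join J Q) + dim S"
    using dim_join[OF _ S, of "join J Q"] eq by simp
  moreover have "dim (join (join J S) Q) = dim S + dim J + (if Q \<subseteq> join J S then 0 else 1)"
    using dim_join_point[OF Q, of "join J S"] dJS by simp
  moreover have "dim (join J Q) = dim J + (if Q \<subseteq> J then 0 else 1)"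
    using dim_join_point[OF Q J] by simp
  moreover have "Q \<subseteq> J \<Longrightarrow> Q \<subseteq> join J S" using join_upper by blast
  ultimately show ?thesis by (auto split: if_splits)
qed

text \<open>The number of \<open>k\<close>-spaces that contain a given \<open>j\<close>-space and
  meet a given \<open>s\<close>-space trivially, the two given spaces being independent. Factor
  \<open>i\<close> belongs to the growth of an \<open>i\<close>-dimensional partial space by a
  point: the numerator counts the admissible points, the denominator those lying in one final space.
  For \<open>s = 0\<close> all extensions are counted, so \<open>ext_count k 0 1\<close> is the size
  of a star. The value 0 for \<open>j > k\<close> keeps \<open>ext_count_rec\<close> valid for every
  \<open>j\<close>.\<close>

definition ext_count :: "nat \<Rightarrow> nat \<Rightarrow> nat \<Rightarrow> real" where
  "ext_count k s j = (if j \<le> k then \<Prod>i=j..<k. (br dimension - br (s + i)) / (br k - br i) else 0)"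

text \<open>By \<open>join_point_disjoint_iff\<close> the points that enlarge a partial space
  \<open>J\<close> without meeting \<open>S\<close> are those outside \<open>join J S\<close>, so
  their number depends only on \<open>dim J\<close>.\<close>

lemma card_extensions_disjoint:
  assumes S: "subspace S" and J: "subspace J" "dim (J \<inter> S) = 0"
  shows "real (card {T \<in> subspaces_of_dim scale k. J \<subseteq> T \<and> dim (T \<inter> S) = 0}) = ext_count k (dim S) (dim J)"
proof (cases "dim J \<le> k")
  case True
  have "real (card {T \<in> subspaces_of_dim scale k. J \<subseteq> T \<and> dim (T \<inter> S) = 0})
    = (\<Prod>i=dim J..<k. (br dimension - br (dim S + i)) / (br k - br i))"
  proof (rule card_good_extensions[where good = "\<lambda>T. dim (T \<inter> S) = 0"])
    show "dim (J \<inter> S) = 0" if "dim (T \<inter> S) = 0" "J \<subseteq> T" for T J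
      using that dim_subset[of "J \<inter> S" "T \<inter> S"] by auto
    fix J assume J: "subspace J" "dim (J \<inter> S) = 0"
    have dJS: "dim (join J S) = dim S + dim J" using dim_join[OF J(1) S] J by simp
    have "{Q \<in> points UNIV. \<not> Q \<subseteq> J \<and> dim (join J Q \<inter> S) = 0}
        = {Q \<in> points UNIV. \<not> Q \<subseteq> join J S}"
      using join_point_disjoint_iff[OF _ J(1) S J(2)] by (auto simp: points_def)
    then show "real (card {Q \<in> points UNIV. \<not> Q \<subseteq> J \<and> dim (join J Q \<inter> S) = 0})
        = br dimension - br (dim S + dim J)"
      using card_points_diff[OF subspace_UNIV, of "join J S"] dJS by (simp add: dimension_def)
  qed (use assms True in auto)
  then show ?thesis using True by (simp add: ext_count_def)
next
  case False
  then have "\<not> J \<subseteq> T" if "T \<in> subspaces_of_dim scale k" for T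
    using that dim_subset[of J T] by (auto simp: subspaces_of_dim_def)
  then have "{T \<in> subspaces_of_dim scale k. J \<subseteq> T \<and> dim (T \<inter> S) = 0} = {}" by auto
  then show ?thesis using False by (simp add: ext_count_def)
qed

lemma card_extensions:
  assumes "subspace J"
  shows "real (card {T \<in> subspaces_of_dim scale k. J \<subseteq> T}) = ext_count k 0 (dim J)"
proof -
  have "dim (T \<inter> {0}) = 0" for T by (simp add: dim_eq_0)
  then show ?thesis
    using card_extensions_disjoint[of "{0}" J k] assms by simp
qed

subsection \<open>Sums of weights\<close>

text \<open>The nested comprehension is the shape in which \<open>sum_weight\<close> leaves its
  incidence counts.\<close>

lemma card_join_extensions:
  assumes "subspace J" "P \<in> points UNIV"
  shows "real (card {T \<in> {T \<in> subspaces_of_dim scale k. J \<subseteq> T}. P \<subseteq> T})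
    = ext_count k 0 (if P \<subseteq> J then dim J else dim J + 1)"
proof -
  have "join J P \<subseteq> T \<longleftrightarrow> J \<subseteq> T \<and> P \<subseteq> T" if "T \<in> subspaces_of_dim scale k" for T
    using that by (simp add: join_subset_iff subspaces_of_dimD(1))
  then have "{T \<in> {T \<in> subspaces_of_dim scale k. J \<subseteq> T}. P \<subseteq> T}
      = {T \<in> subspaces_of_dim scale k. join J P \<subseteq> T}" by auto
  then show ?thesis
    using card_extensions[of "join J P" k] dim_join_point[of P J] assms by (simp add: points_def)
qed

text \<open>Written without division so that it also covers \<open>j \<ge> k\<close>, where both
  sides vanish.\<close>

lemma ext_count_rec:
  "ext_count k s j * (br k - br j) = (br dimension - br (s + j)) * ext_count k s (Suc j)"
proof (cases "j < k")
  case True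
  then show ?thesis
    using br_strict_mono[OF True] by (simp add: ext_count_def prod.atLeast_Suc_lessThan)
qed (auto simp: ext_count_def)

lemma ext_count_nonneg: "s + k \<le> dimension \<Longrightarrow> 0 \<le> ext_count k s j"
  unfolding ext_count_def by (auto intro!: prod_nonneg divide_nonneg_nonneg br_mono)

lemma ext_count_pos: "s + k \<le> dimension \<Longrightarrow> j \<le> k \<Longrightarrow> 0 < ext_count k s j"
  unfolding ext_count_def by (auto intro!: prod_pos divide_pos_pos br_strict_mono)

lemma ext_count_less:
  assumes "k < dimension" "j \<le> k"
  shows "ext_count k 0 (Suc j) < ext_count k 0 j"
proof -
  have "br k - br j < br dimension - br j" using br_strict_mono[OF assms(1)] by simp
  then have "ext_count k 0 j * (br k - br j) < ext_count k 0 j * (br dimension - br j)"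
    using ext_count_pos[of 0 k j] assms by (intro mult_strict_left_mono) auto
  then show ?thesis
    using ext_count_rec[of k 0 j] br_mono[of j dimension] assms br_strict_mono[of j dimension]
    by (simp add: mult.commute)
qed

lemma weight_eq: "weight scale f S = sum f (points S)"
  by (simp add: weight_def points_def)

lemma sum_weight:
  "(\<Sum>T\<in>E. weight scale f T) = (\<Sum>P\<in>points UNIV. f P * real (card {T \<in> E. P \<subseteq> T}))"
proof -
  have "(\<Sum>T\<in>E. weight scale f T) = (\<Sum>T\<in>E. sum f {P \<in> points UNIV. P \<subseteq> T})"
    by (intro sum.cong) (auto simp: weight_eq points_def)
  also have "\<dots> = (\<Sum>P\<in>points UNIV. \<Sum>T | T \<in> E \<and> P \<subseteq> T. f P)"
    by (rule sum.swap_restrict) auto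
  finally show ?thesis by (simp add: mult.commute)
qed

lemma sum_weight_product:
  "(\<Sum>T\<in>E. (weight scale f T)\<^sup>2)
    = (\<Sum>P\<in>points UNIV. \<Sum>Q\<in>points UNIV. f P * f Q * real (card {T \<in> E. P \<subseteq> T \<and> Q \<subseteq> T}))"
proof -
  have "(weight scale f T)\<^sup>2
      = (\<Sum>P\<in>points UNIV. \<Sum>Q\<in>points UNIV. f P * f Q * (if P \<subseteq> T \<and> Q \<subseteq> T then 1 else 0))" for T
  proof -
    have "weight scale f T = (\<Sum>P\<in>points UNIV. f P * (if P \<subseteq> T then 1 else 0))"
      unfolding weight_eq by (rule sum.mono_neutral_cong_left) (auto simp: points_def)
    then show ?thesis
      unfolding power2_eq_square by (simp only: sum_product) (auto intro!: sum.cong)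
  qed
  then have "(\<Sum>T\<in>E. (weight scale f T)\<^sup>2) = (\<Sum>T\<in>E. \<Sum>P\<in>points UNIV. \<Sum>Q\<in>points UNIV.
      f P * f Q * (if P \<subseteq> T \<and> Q \<subseteq> T then 1 else 0))" by simp
  also have "\<dots> = (\<Sum>P\<in>points UNIV. \<Sum>Q\<in>points UNIV. \<Sum>T\<in>E.
      f P * f Q * (if P \<subseteq> T \<and> Q \<subseteq> T then 1 else 0))"
    by (subst sum.swap, rule sum.cong[OF refl], rule sum.swap)
  also have "\<dots> = (\<Sum>P\<in>points UNIV. \<Sum>Q\<in>points UNIV. f P * f Q * real (card {T \<in> E. P \<subseteq> T \<and> Q \<subseteq> T}))"
    by (intro sum.cong refl) (simp only: sum_distrib_left[symmetric], simp add: sum.If_cases Int_def)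
  finally show ?thesis .
qed

text \<open>Serves families in which the number of members through a point depends only on whether
  the point lies in \<open>J\<close>: if \<open>f\<close> sums to 0, the family has total weight
  \<open>a - b\<close> times that of \<open>J\<close>.\<close>

lemma sum_points_split:
  fixes a b :: real
  assumes "subspace J"
  shows "(\<Sum>P\<in>points UNIV. f P * (if P \<subseteq> J then a else b))
    = a * weight scale f J + b * (sum f (points UNIV) - weight scale f J)"
proof -
  have eq: "points UNIV \<inter> {P. P \<subseteq> J} = points J" by (auto simp: points_def)
  have "sum f (points UNIV) = sum f (points J) + sum f (points UNIV \<inter> - {P. P \<subseteq> J})"
    using sum.Int_Diff[of "points UNIV" f "{P. P \<subseteq> J}"] eq by (simp add: Diff_eq)
  moreover have "(\<Sum>P\<in>points UNIV. f P * (if P \<subseteq> J then a else b))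
      = (\<Sum>P\<in>points UNIV. if P \<subseteq> J then f P * a else f P * b)"
    by (intro sum.cong) auto
  ultimately show ?thesis
    by (simp add: sum.If_cases eq weight_eq sum_distrib_left mult.commute)
qed

lemma sum_weight_extensions:
  assumes "subspace J" "sum f (points UNIV) = 0"
  shows "(\<Sum>T | T \<in> subspaces_of_dim scale k \<and> J \<subseteq> T. weight scale f T)
    = (ext_count k 0 (dim J) - ext_count k 0 (Suc (dim J))) * weight scale f J"
proof -
  have "(\<Sum>T | T \<in> subspaces_of_dim scale k \<and> J \<subseteq> T. weight scale f T)
    = (\<Sum>P\<in>points UNIV. f P * (if P \<subseteq> J then ext_count k 0 (dim J) else ext_count k 0 (Suc (dim J))))"
    unfolding sum_weight using card_join_extensions[OF assms(1)] by (intro sum.cong) auto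
  then show ?thesis using assms by (simp add: sum_points_split algebra_simps)
qed

lemma sum_weight_all:
  assumes "sum f (points UNIV) = 0"
  shows "(\<Sum>T\<in>subspaces_of_dim scale k. weight scale f T) = 0"
proof -
  \<comment> \<open>All \<open>k\<close>-spaces are extensions of \<open>{0}\<close>, which has no
    points and hence weight 0.\<close>
  have "{0} \<subseteq> T" if "T \<in> subspaces_of_dim scale k" for T
    using that subspace_0[OF subspaces_of_dimD(1)] by simp
  then have eq: "{T. T \<in> subspaces_of_dim scale k \<and> {0} \<subseteq> T} = subspaces_of_dim scale k"
    by (metis (mono_tags) Collect_cong Collect_mem_eq)
  have "points {0} = {}" using card_points[of "{0}"] by simp
  then show ?thesis using sum_weight_extensions[of "{0}" f k] assms unfolding eq by (simp add: weight_eq)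
qed

text \<open>A point of \<open>S\<close> lies in none of these spaces, any other point in
  \<open>ext_count k (dim S) 1\<close> of them; the points outside \<open>S\<close> have total value
  minus the weight of \<open>S\<close>.\<close>

lemma sum_weight_disjoint:
  assumes S: "subspace S" and f: "sum f (points UNIV) = 0"
  shows "(\<Sum>T | T \<in> subspaces_of_dim scale k \<and> dim (T \<inter> S) = 0. weight scale f T)
    = - ext_count k (dim S) 1 * weight scale f S"
proof -
  have "real (card {T \<in> {T \<in> subspaces_of_dim scale k. dim (T \<inter> S) = 0}. P \<subseteq> T})
      = (if P \<subseteq> S then 0 else ext_count k (dim S) 1)" if "P \<in> points UNIV" for P
  proof -
    have P: "P \<in> subspaces_of_dim scale 1" "subspace P" "dim P = 1"
      using that by (auto simp: points_def subspaces_of_dim_def)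
    have eq: "{T \<in> {T \<in> subspaces_of_dim scale k. dim (T \<inter> S) = 0}. P \<subseteq> T}
        = {T \<in> subspaces_of_dim scale k. P \<subseteq> T \<and> dim (T \<inter> S) = 0}" by auto
    show ?thesis
    proof (cases "P \<subseteq> S")
      case True
      have "\<not> (P \<subseteq> T \<and> dim (T \<inter> S) = 0)" for T
        using dim_subset[of P "T \<inter> S"] True P(3) by auto
      then have "{T \<in> subspaces_of_dim scale k. P \<subseteq> T \<and> dim (T \<inter> S) = 0} = {}" by simp
      then show ?thesis unfolding eq using True by simp
    next
      case False
      then show ?thesis
        using card_extensions_disjoint[OF S P(2), of k] point_Int[OF P(1) S False] P eq
        by (simp add: Int_commute)
    qed
  qed
  then have "(\<Sum>T | T \<in> subspaces_of_dim scale k \<and> dim (T \<inter> S) = 0. weight scale f T)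
      = (\<Sum>P\<in>points UNIV. f P * (if P \<subseteq> S then 0 else ext_count k (dim S) 1))"
    unfolding sum_weight by (intro sum.cong) auto
  then show ?thesis using assms by (simp add: sum_points_split)
qed

text \<open>Complementary to \<open>sum_weight_disjoint\<close>, because all \<open>k\<close>-spaces
  together have weight 0.\<close>

lemma sum_weight_meeting:
  assumes S: "subspace S" and f: "sum f (points UNIV) = 0"
  shows "(\<Sum>T | T \<in> subspaces_of_dim scale k \<and> dim (T \<inter> S) \<noteq> 0. weight scale f T)
    = ext_count k (dim S) 1 * weight scale f S"
proof -
  let ?G = "subspaces_of_dim scale k"
  have "(\<Sum>T\<in>?G. weight scale f T) = (\<Sum>T | T \<in> ?G \<and> dim (T \<inter> S) = 0. weight scale f T)
      + (\<Sum>T | T \<in> ?G \<and> dim (T \<inter> S) \<noteq> 0. weight scale f T)"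
    by (subst sum.union_disjoint[symmetric]) (auto intro: sum.cong)
  then show ?thesis using sum_weight_disjoint[OF assms] sum_weight_all[OF f] by simp
qed

text \<open>Expanding the squares leads to pairs of points: a point lies in
  \<open>ext_count k 0 1\<close> spaces, two distinct points in \<open>ext_count k 0 2\<close>. The
  term with the total of \<open>f\<close> matters when \<open>f\<close> is the indicator of the
  points of a subspace.\<close>

lemma sum_weight_squares:
  "(\<Sum>T\<in>subspaces_of_dim scale k. (weight scale f T)\<^sup>2)
    = (ext_count k 0 1 - ext_count k 0 2) * (\<Sum>P\<in>points UNIV. (f P)\<^sup>2)
      + ext_count k 0 2 * (sum f (points UNIV))\<^sup>2"
proof -
  let ?G = "subspaces_of_dim scale k"
  have c: "real (card {T \<in> ?G. P \<subseteq> T \<and> Q \<subseteq> T})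
      = ext_count k 0 2 + (if P = Q then ext_count k 0 1 - ext_count k 0 2 else 0)"
    if "P \<in> points UNIV" "Q \<in> points UNIV" for P Q
  proof -
    have P: "subspace P" "dim P = 1" and Q: "subspace Q" "dim Q = 1"
      using that by (auto simp: points_def subspaces_of_dim_def)
    have "Q \<subseteq> P \<longleftrightarrow> P = Q" using subspace_dim_equal[of Q P] P Q by auto
    then show ?thesis using card_join_extensions[OF P(1) that(2), of k] P Q
      by (cases "P = Q") (auto simp: numeral_2_eq_2)
  qed
  have "(\<Sum>T\<in>?G. (weight scale f T)\<^sup>2) = (\<Sum>P\<in>points UNIV. \<Sum>Q\<in>points UNIV.
      f P * f Q * ext_count k 0 2 + (if P = Q then f P * f Q * (ext_count k 0 1 - ext_count k 0 2) else 0))"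
    unfolding sum_weight_product by (intro sum.cong refl) (simp add: c distrib_left)
  also have "\<dots> = (\<Sum>P\<in>points UNIV. \<Sum>Q\<in>points UNIV. f P * f Q * ext_count k 0 2)
      + (ext_count k 0 1 - ext_count k 0 2) * (\<Sum>P\<in>points UNIV. (f P)\<^sup>2)"
    by (simp add: sum.distrib sum.delta sum_distrib_right power2_eq_square mult.commute[of "ext_count k 0 (Suc 0) - ext_count k 0 2"])
  also have "(\<Sum>P\<in>points UNIV. \<Sum>Q\<in>points UNIV. f P * f Q * ext_count k 0 2)
      = sum f (points UNIV) * sum f (points UNIV) * ext_count k 0 2"
    unfolding sum_product by (simp only: sum_distrib_right)
  finally show ?thesis by (simp add: power2_eq_square)
qed

subsection \<open>Weights of the subspaces through a point\<close>

text \<open>The pairs of points \<open>Q\<close>, \<open>R\<close> on a common line with \<open>P\<close> form a symmetric relation in which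
  every \<open>Q\<close> has \<open>q\<close> partners, so by AM-GM they contribute at most \<open>q\<close> times the sum of squares.\<close>

lemma sum_collinear_le:
  assumes P: "P \<in> points UNIV" and g: "g P = (0::real)"
  shows "(\<Sum>Q\<in>points UNIV. \<Sum>R\<in>points UNIV. g Q * g R * (if R \<subseteq> join P Q then 1 else 0))
    \<le> q * (\<Sum>Q\<in>points UNIV. (g Q)\<^sup>2)"
proof -
  define X where "X = points UNIV - {P}"
  have pt: "subspace Q" "dim Q = 1" "Q \<in> subspaces_of_dim scale 1" if "Q \<in> X" for Q
    using that by (auto simp: X_def points_def subspaces_of_dim_def)
  have PP: "subspace P" "dim P = 1" "P \<in> subspaces_of_dim scale 1"
    using P by (auto simp: points_def subspaces_of_dim_def)
  have not_sub: "\<not> Q \<subseteq> P" if "Q \<in> X" for Q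
    using subspace_dim_equal[of Q P] pt[OF that] PP that by (auto simp: X_def)
  have dim_line: "dim (join P Q) = 2" if "Q \<in> X" for Q
    using dim_join_point[OF pt(3)[OF that] PP(1)] not_sub[OF that] PP by simp
  have sym: "Q \<subseteq> join P R" if "Q \<in> X" "R \<in> X" "R \<subseteq> join P Q" for Q R
  proof -
    have "join P R \<subseteq> join P Q" using that join_upper by (simp add: join_subset_iff)
    then have "join P R = join P Q"
      using dim_line that by (intro subspace_dim_equal) auto
    then show ?thesis using join_upper by simp
  qed
  then have sym': "R \<subseteq> join P Q \<longleftrightarrow> Q \<subseteq> join P R" if "Q \<in> X" "R \<in> X" for Q R
    using that by blast
  have card_line: "real (card {R \<in> X. R \<subseteq> join P Q}) = q" if "Q \<in> X" for Q
  proof -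
    have "{R \<in> X. R \<subseteq> join P Q} = points (join P Q) - {P}" by (auto simp: X_def points_def)
    moreover have "P \<in> points (join P Q)" using PP join_upper by (simp add: points_def)
    moreover have "real (card (points (join P Q))) = q + 1"
      using card_points[of "join P Q"] dim_line[OF that] by (simp add: br_2)
    moreover from calculation(2) have "card (points (join P Q)) \<ge> 1"
      by (simp add: Suc_le_eq card_gt_0_iff) blast
    ultimately show ?thesis by (simp add: card_Diff_singleton of_nat_diff)
  qed
  define r :: "'b set \<Rightarrow> 'b set \<Rightarrow> real" where "r Q R = (if R \<subseteq> join P Q then 1 else 0)" for Q R
  have rsum: "(\<Sum>R\<in>X. r Q R) = q" if "Q \<in> X" for Q
    using card_line[OF that] by (simp add: r_def sum.If_cases Int_def)
  have "(\<Sum>Q\<in>points UNIV. \<Sum>R\<in>points UNIV. g Q * g R * r Q R) = (\<Sum>Q\<in>X. \<Sum>R\<in>X. g Q * g R * r Q R)"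
    unfolding X_def using g
    by (intro sum.mono_neutral_cong_right) (auto intro!: sum.mono_neutral_right)
  also have "\<dots> \<le> (\<Sum>Q\<in>X. \<Sum>R\<in>X. ((g Q)\<^sup>2 / 2 * r Q R + (g R)\<^sup>2 / 2 * r R Q))"
  proof (intro sum_mono)
    fix Q R assume "Q \<in> X" "R \<in> X"
    then have "r R Q = r Q R" using sym' by (simp add: r_def)
    moreover have "g Q * g R \<le> (g Q)\<^sup>2 / 2 + (g R)\<^sup>2 / 2"
      using sum_squares_bound[of "g Q" "g R"] by simp
    ultimately show "g Q * g R * r Q R \<le> (g Q)\<^sup>2 / 2 * r Q R + (g R)\<^sup>2 / 2 * r R Q"
      by (auto simp: r_def)
  qed
  also have "\<dots> = (\<Sum>Q\<in>X. \<Sum>R\<in>X. (g Q)\<^sup>2 / 2 * r Q R) + (\<Sum>R\<in>X. \<Sum>Q\<in>X. (g R)\<^sup>2 / 2 * r R Q)"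
    by (simp only: sum.distrib, subst sum.swap[of _ X X], simp)
  also have "\<dots> = q * (\<Sum>Q\<in>X. (g Q)\<^sup>2)"
    by (simp add: sum_distrib_left[symmetric] rsum sum_divide_distrib[symmetric] sum_distrib_right[symmetric])
  also have "(\<Sum>Q\<in>X. (g Q)\<^sup>2) = (\<Sum>Q\<in>points UNIV. (g Q)\<^sup>2)"
    unfolding X_def using g by (intro sum.mono_neutral_left) auto
  finally show ?thesis by (simp add: r_def)
qed

text \<open>A second moment around \<open>f P\<close>. Points \<open>Q\<close> and \<open>R\<close>
  other than \<open>P\<close> lie jointly in \<open>ext_count k 0 2\<close> of the spaces through
  \<open>P\<close> if \<open>R\<close> is on the line of \<open>P\<close> and \<open>Q\<close>, and
  in \<open>ext_count k 0 3\<close> otherwise. The constant part of this count multiplies the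
  squared total of the remaining values, the excess is handled by
  \<open>sum_collinear_le\<close>.\<close>

lemma local_variance_le:
  assumes k: "k < dimension" "2 \<le> k" and P: "P \<in> points UNIV" and f: "sum f (points UNIV) = 0"
  shows "(\<Sum>T | T \<in> subspaces_of_dim scale k \<and> P \<subseteq> T. (weight scale f T - f P)\<^sup>2)
    \<le> ext_count k 0 3 * (f P)\<^sup>2
      + (ext_count k 0 2 - ext_count k 0 3) * q * ((\<Sum>Q\<in>points UNIV. (f Q)\<^sup>2) - (f P)\<^sup>2)"
proof -
  \<comment> \<open>Setting the value at \<open>P\<close> to 0 turns the deviation from
    \<open>f P\<close> into a weight, and the new total is \<open>- f P\<close>.\<close>
  define g where "g = f(P := 0)"
  define E where "E = {T. T \<in> subspaces_of_dim scale k \<and> P \<subseteq> T}"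
  define m where "m = ext_count k 0 2"
  define l where "l = ext_count k 0 3"
  have PP: "subspace P" "dim P = 1" "P \<in> subspaces_of_dim scale 1"
    using P by (auto simp: points_def subspaces_of_dim_def)
  have w: "weight scale f T - f P = weight scale g T" if "T \<in> E" for T
  proof -
    have "P \<in> points T" using that PP by (auto simp: E_def points_def)
    then show ?thesis by (simp add: weight_eq g_def sum.remove[of "points T" P])
  qed
  have c: "real (card {T \<in> E. Q \<subseteq> T \<and> R \<subseteq> T}) = l + (m - l) * (if R \<subseteq> join P Q then 1 else 0)"
    if "Q \<in> points UNIV" "Q \<noteq> P" "R \<in> points UNIV" for Q R
  proof -
    have Q: "Q \<in> subspaces_of_dim scale 1" "subspace Q" "dim Q = 1"
      using that by (auto simp: points_def subspaces_of_dim_def)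
    have "\<not> Q \<subseteq> P" using subspace_dim_equal[of Q P] PP Q that by auto
    then have d: "dim (join P Q) = 2" using dim_join_point[OF Q(1) PP(1)] PP by simp
    have "join P Q \<subseteq> T \<longleftrightarrow> P \<subseteq> T \<and> Q \<subseteq> T" if "T \<in> subspaces_of_dim scale k" for T
      using that by (simp add: join_subset_iff subspaces_of_dimD(1))
    then have "{T \<in> E. Q \<subseteq> T \<and> R \<subseteq> T} = {T \<in> {T \<in> subspaces_of_dim scale k. join P Q \<subseteq> T}. R \<subseteq> T}"
      by (auto simp: E_def)
    then show ?thesis
      using card_join_extensions[of "join P Q" R k] that(3) d by (simp add: m_def l_def)
  qed
  have "(\<Sum>T\<in>E. (weight scale f T - f P)\<^sup>2) = (\<Sum>T\<in>E. (weight scale g T)\<^sup>2)"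
    using w by (intro sum.cong) auto
  also have "\<dots> = (\<Sum>Q\<in>points UNIV. \<Sum>R\<in>points UNIV.
      l * (g Q * g R) + (m - l) * (g Q * g R * (if R \<subseteq> join P Q then 1 else 0)))"
    unfolding sum_weight_product
  proof (intro sum.cong refl)
    fix Q R assume *: "Q \<in> points UNIV" "R \<in> points UNIV"
    show "g Q * g R * real (card {T \<in> E. Q \<subseteq> T \<and> R \<subseteq> T})
      = l * (g Q * g R) + (m - l) * (g Q * g R * (if R \<subseteq> join P Q then 1 else 0))"
    proof (cases "Q = P")
      case False
      show ?thesis unfolding c[OF *(1) False *(2)] by (simp add: algebra_simps)
    qed (simp add: g_def)
  qed
  also have "\<dots> = l * (sum g (points UNIV))\<^sup>2
      + (m - l) * (\<Sum>Q\<in>points UNIV. \<Sum>R\<in>points UNIV. g Q * g R * (if R \<subseteq> join P Q then 1 else 0))"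
    by (simp only: power2_eq_square sum_product sum.distrib) (simp only: sum_distrib_left)
  also have "\<dots> \<le> l * (sum g (points UNIV))\<^sup>2 + (m - l) * (q * (\<Sum>Q\<in>points UNIV. (g Q)\<^sup>2))"
  proof -
    have "l \<le> m"
      using ext_count_less[of k 2] k by (simp add: m_def l_def numeral_3_eq_3 numeral_2_eq_2)
    then show ?thesis using sum_collinear_le[OF P, of g] by (simp add: g_def mult_left_mono)
  qed
  also have "sum g (points UNIV) = - f P"
    using f P by (simp add: g_def sum.remove[of "points UNIV" P])
  also have "(\<Sum>Q\<in>points UNIV. (g Q)\<^sup>2) = (\<Sum>Q\<in>points UNIV. (f Q)\<^sup>2) - (f P)\<^sup>2"
    using P by (simp add: g_def sum.remove[of "points UNIV" P])
  finally show ?thesis by (simp add: E_def m_def l_def mult.assoc)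
qed

text \<open>For \<open>j < k\<close> the quotient of the two differences in
  \<open>ext_count_rec\<close> is at least \<open>q\<close>, hence at least 2.\<close>

lemma ext_count_half:
  assumes "k < dimension"
  shows "2 * ext_count k 0 (Suc j) \<le> ext_count k 0 j"
proof (cases "j < k")
  case True
  have "q * (q ^ k - q ^ j) \<le> q ^ dimension - q ^ j"
  proof -
    have "q * q ^ k \<le> q ^ dimension" using assms q_ge_2 power_increasing[of "Suc k" dimension q] by simp
    moreover have "1 * q ^ j \<le> q * q ^ j" using q_ge_2 by (intro mult_right_mono) auto
    ultimately show ?thesis by (simp add: algebra_simps)
  qed
  then have *: "q * (br k - br j) \<le> br dimension - br j"
    using q_ge_2 by (simp add: br_diff divide_right_mono)
  have pos: "br k - br j > 0" using br_strict_mono[OF True] by simp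
  have e: "0 \<le> ext_count k 0 (Suc j)" using ext_count_nonneg assms by simp
  have "2 * ext_count k 0 (Suc j) * (br k - br j) \<le> q * (br k - br j) * ext_count k 0 (Suc j)"
    using q_ge_2 pos e by (simp add: mult_right_mono mult_left_mono mult.commute mult.left_commute)
  also have "\<dots> \<le> ext_count k 0 j * (br k - br j)"
    using mult_right_mono[OF * e] ext_count_rec[of k 0 j] by simp
  finally show ?thesis using pos by simp
next
  case False
  then show ?thesis using ext_count_nonneg[of 0 k j] assms by (simp add: ext_count_def)
qed

text \<open>The last term is the contribution of the mean: by Cauchy-Schwarz the square of the total weight
  of \<open>Y\<close>, which dominates that of all \<open>k\<close>-spaces through \<open>P\<close>, is at most \<open>card Y\<close> times the sum of
  squares over \<open>Y\<close>.\<close>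

lemma nonneg_squares_through_point:
  assumes k: "k < dimension" "2 \<le> k" and P: "P \<in> points UNIV" and f: "sum f (points UNIV) = 0"
  defines "Y \<equiv> {T \<in> nonneg_subspaces scale f k. P \<subseteq> T}"
  defines "M \<equiv> ext_count k 0 1"
  shows "M * (\<Sum>T\<in>Y. (weight scale f T)\<^sup>2)
    \<le> M * (q * ext_count k 0 2 * (\<Sum>Q\<in>points UNIV. (f Q)\<^sup>2))
      + real (card Y) * (\<Sum>T\<in>Y. (weight scale f T)\<^sup>2)"
proof -
  define E where "E = {T. T \<in> subspaces_of_dim scale k \<and> P \<subseteq> T}"
  define m where "m = ext_count k 0 2"
  define l where "l = ext_count k 0 3"
  define F where "F = (\<Sum>Q\<in>points UNIV. (f Q)\<^sup>2)"
  define a where "a = f P"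
  let ?w = "weight scale f"
  define V where "V = (\<Sum>T\<in>E. (?w T - a)\<^sup>2)"
  have PP: "subspace P" "dim P = 1" using P by (auto simp: points_def subspaces_of_dim_def)
  have YE: "Y \<subseteq> E" by (auto simp: Y_def E_def nonneg_subspaces_def)
  have wP: "?w P = a"
  proof -
    have "points P = {P}"
    proof -
      have "card (points P) = 1" using card_points[OF PP(1)] PP by simp
      moreover have "P \<in> points P" using P by (simp add: points_def)
      ultimately show ?thesis by (auto simp: card_1_singleton_iff)
    qed
    then show ?thesis by (simp add: weight_eq a_def)
  qed
  have mean: "(\<Sum>T\<in>E. ?w T) = (M - m) * a"
    using sum_weight_extensions[OF PP(1) f, of k] PP wP by (simp add: E_def M_def m_def numeral_2_eq_2)
  have cE: "real (card E) = M"
    using card_extensions[OF PP(1), of k] PP by (simp add: E_def M_def)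
  have lm: "0 \<le> l" "2 * l \<le> m" "2 * m \<le> M"
    using ext_count_half[OF k(1), of 2] ext_count_half[OF k(1), of 1] ext_count_nonneg[of 0 k 3] k
    by (simp_all add: l_def m_def M_def numeral_2_eq_2 numeral_3_eq_3)
  have F: "a\<^sup>2 \<le> F" unfolding F_def a_def using P by (intro member_le_sum) auto
  have V: "V \<le> q * m * F"
  proof -
    have "V \<le> l * a\<^sup>2 + (m - l) * q * (F - a\<^sup>2)"
      using local_variance_le[OF k P f] by (simp add: V_def E_def a_def l_def m_def F_def)
    also have "\<dots> = q * m * F - q * l * F - ((m - l) * q - l) * a\<^sup>2" by (simp add: algebra_simps)
    also have "\<dots> \<le> q * m * F"
    proof -
      have "l \<le> (m - l) * 1" using lm by simp
      also have "\<dots> \<le> (m - l) * q" using lm q_ge_2 by (intro mult_left_mono) auto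
      finally have "0 \<le> ((m - l) * q - l) * a\<^sup>2" by simp
      moreover have "0 \<le> q * l * F" using lm q_ge_2 F by (simp add: order_trans[OF zero_le_power2])
      ultimately show ?thesis by simp
    qed
    finally show ?thesis .
  qed
  define s2 where "s2 = (\<Sum>T\<in>Y. (?w T)\<^sup>2)"
  have s2: "0 \<le> s2" by (simp add: s2_def sum_nonneg)
  have M0: "0 \<le> M" using lm by simp
  have "M * s2 \<le> M * (q * m * F) + real (card Y) * s2"
  \<comment> \<open>If \<open>a\<close> is negative, a nonnegative weight is at most its distance
    from \<open>a\<close>, so \<open>V\<close> alone bounds \<open>s2\<close>. Otherwise the mean
    contributes and is absorbed by Cauchy-Schwarz.\<close>
  proof (cases "0 \<le> a")
    case True
    have "(M - m) * a \<le> (\<Sum>T\<in>Y. ?w T)"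
    proof -
      have "(\<Sum>T\<in>E. ?w T) = (\<Sum>T\<in>Y. ?w T) + (\<Sum>T\<in>E - Y. ?w T)"
        using YE by (simp add: sum.subset_diff)
      moreover have "(\<Sum>T\<in>E - Y. ?w T) \<le> 0"
        by (intro sum_nonpos) (auto simp: E_def Y_def nonneg_subspaces_def)
      ultimately show ?thesis using mean by simp
    qed
    then have "((M - m) * a)\<^sup>2 \<le> (\<Sum>T\<in>Y. ?w T)\<^sup>2" using True lm by (intro power_mono) auto
    also have "\<dots> \<le> real (card Y) * s2"
      using sum_squared_le_sum_of_squares[of ?w Y] by (simp add: s2_def mult.commute)
    finally have 1: "((M - m) * a)\<^sup>2 \<le> real (card Y) * s2" .
    have "s2 \<le> (\<Sum>T\<in>E. (?w T)\<^sup>2)" unfolding s2_def using YE by (intro sum_mono2) auto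
    also have "\<dots> = V + 2 * a * (\<Sum>T\<in>E. ?w T) - real (card E) * a\<^sup>2"
      by (simp add: V_def power2_diff sum.distrib sum_subtractf sum_distrib_left[symmetric]
          sum_distrib_right[symmetric] algebra_simps)
    also have "\<dots> = V + (M - 2 * m) * a\<^sup>2" by (simp add: mean cE power2_eq_square algebra_simps)
    finally have "s2 \<le> q * m * F + (M - 2 * m) * a\<^sup>2" using V by simp
    then have "M * s2 \<le> M * (q * m * F + (M - 2 * m) * a\<^sup>2)" using M0 by (rule mult_left_mono)
    also have "\<dots> \<le> M * (q * m * F) + ((M - m) * a)\<^sup>2"
    proof -
      have "((M - m) * a)\<^sup>2 - M * ((M - 2 * m) * a\<^sup>2) = (m * a)\<^sup>2"
        by (simp add: power2_eq_square algebra_simps)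
      then have "M * ((M - 2 * m) * a\<^sup>2) \<le> ((M - m) * a)\<^sup>2"
        by (metis diff_ge_0_iff_ge zero_le_power2)
      then show ?thesis by (simp add: algebra_simps)
    qed
    finally show ?thesis using 1 by simp
  next
    case False
    have "s2 \<le> (\<Sum>T\<in>Y. (?w T - a)\<^sup>2)"
      unfolding s2_def using False
      by (intro sum_mono power_mono) (auto simp: Y_def nonneg_subspaces_def)
    also have "\<dots> \<le> V" unfolding V_def using YE by (intro sum_mono2) auto
    finally have "M * s2 \<le> M * (q * m * F)" using V M0 by (intro mult_left_mono) auto
    then show ?thesis using s2 by (simp add: add_increasing2)
  qed
  then show ?thesis by (simp add: s2_def m_def F_def)
qed

subsection \<open>Complements of a subspace of negative weight\<close>

text \<open>A partial space \<open>J\<close> can grow by the points outside both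
  \<open>join J W\<close> and \<open>join J S\<close>. These two span everything, so their
  intersection has dimension \<open>2 * dim J\<close>, and inclusion-exclusion gives a number
  depending only on \<open>dim J\<close>. Hence the count is the same for every
  \<open>Q\<close>.\<close>

lemma card_extensions_disjoint2:
  assumes W: "subspace W" and S: "subspace S" and WS: "dim (W \<inter> S) = 0" "dim W + dim S = dimension"
  shows "\<exists>c. \<forall>Q\<in>points UNIV. \<not> Q \<subseteq> W \<longrightarrow> \<not> Q \<subseteq> S \<longrightarrow>
    real (card {T \<in> subspaces_of_dim scale k. Q \<subseteq> T \<and> dim (T \<inter> W) = 0 \<and> dim (T \<inter> S) = 0}) = c"
proof (cases "1 \<le> k")
  case True
  define good where "good T \<longleftrightarrow> dim (T \<inter> W) = 0 \<and> dim (T \<inter> S) = 0" for T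
  define r where "r i = br dimension - br (dim W + i) - br (dim S + i) + br (2 * i)" for i
  have count: "real (card {Q \<in> points UNIV. \<not> Q \<subseteq> J \<and> good (join J Q)}) = r (dim J)"
    if J: "subspace J" and "good J" for J
  proof -
    have JW: "dim (J \<inter> W) = 0" and JS: "dim (J \<inter> S) = 0" using that by (auto simp: good_def)
    define A B where "A = join J W" and "B = join J S"
    have dA: "dim A = dim W + dim J" and dB: "dim B = dim S + dim J"
      using dim_join[OF J W] dim_join[OF J S] JW JS by (auto simp: A_def B_def)
    have "dim (join W S) = dimension" using dim_join[OF W S] WS by simp
    moreover have "join W S \<subseteq> join A B"
      using join_upper(2)[where A = J and B = W] join_upper(2)[where A = J and B = S]
        join_upper[where A = A and B = B]
      by (simp add: join_subset_iff A_def[symmetric] B_def[symmetric]) blast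
    ultimately have "dim (join A B) = dimension"
      using dim_subset[of "join W S" "join A B"] dim_subset_UNIV[of "join A B"] by linarith
    then have dAB: "dim (A \<inter> B) = 2 * dim J"
      using dim_join[of A B] dA dB WS by (simp add: A_def B_def)
    have "\<not> Q \<subseteq> J \<and> good (join J Q) \<longleftrightarrow> \<not> Q \<subseteq> A \<and> \<not> Q \<subseteq> B" if "Q \<in> points UNIV" for Q
      using join_point_disjoint_iff[OF _ J W JW, of Q] join_point_disjoint_iff[OF _ J S JS, of Q] that
      by (auto simp: points_def good_def A_def B_def)
    then have eq: "{Q \<in> points UNIV. \<not> Q \<subseteq> J \<and> good (join J Q)} = points UNIV - (points A \<union> points B)"
      by (auto simp: points_def)
    have "points A \<inter> points B = points (A \<inter> B)" by (auto simp: points_def)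
    then have "card (points A \<union> points B) + card (points (A \<inter> B)) = card (points A) + card (points B)"
      using card_Un_Int[of "points A" "points B"] by simp
    then have "real (card (points A \<union> points B)) = br (dim A) + br (dim B) - br (dim (A \<inter> B))"
      using card_points[of A] card_points[of B] card_points[of "A \<inter> B"]
      by (simp add: A_def B_def subspace_inter)
    moreover have "points A \<union> points B \<subseteq> points UNIV" by (auto simp: points_def)
    ultimately show ?thesis
      unfolding eq using card_points[OF subspace_UNIV] card_mono[of "points UNIV" "points A \<union> points B"]
      by (simp add: card_Diff_subset of_nat_diff r_def dA dB dAB dimension_def)
  qed
  have "real (card {T \<in> subspaces_of_dim scale k. Q \<subseteq> T \<and> good T}) = (\<Prod>i=1..<k. r i / (br k - br i))"
    if Q: "Q \<in> points UNIV" "\<not> Q \<subseteq> W" "\<not> Q \<subseteq> S" for Q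
  proof -
    have "Q \<in> subspaces_of_dim scale 1" using Q by (simp add: points_def)
    moreover from this have "good Q"
      using point_Int[of Q W] point_Int[of Q S] W S Q by (simp add: good_def Int_commute)
    moreover have "good J" if "good T" "J \<subseteq> T" for T J
      using that dim_subset[of "J \<inter> W" "T \<inter> W"] dim_subset[of "J \<inter> S" "T \<inter> S"]
      by (auto simp: good_def)
    ultimately show ?thesis
      using card_good_extensions[of good k r Q] count True subspaces_of_dimD by fastforce
  qed
  then show ?thesis unfolding good_def by blast
next
  case False
  then have "\<not> Q \<subseteq> T" if "Q \<in> points UNIV" "T \<in> subspaces_of_dim scale k" for Q T
    using that dim_subset[of Q T] by (auto simp: points_def subspaces_of_dim_def)
  then have "{T \<in> subspaces_of_dim scale k. Q \<subseteq> T \<and> dim (T \<inter> W) = 0 \<and> dim (T \<inter> S) = 0} = {}"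
    if "Q \<in> points UNIV" for Q using that by auto
  then show ?thesis by (intro exI[of _ 0]) simp
qed

text \<open>A union bound over the points \<open>R\<close> of \<open>S\<close>: a space counted here
  contains a line \<open>join Q R\<close>, and at most \<open>ext_count k (dim W) 2\<close> spaces
  disjoint from \<open>W\<close> contain a given line.\<close>

lemma card_extensions_meeting_le:
  assumes W: "subspace W" and S: "subspace S" and k: "dim W + k \<le> dimension"
    and Q: "Q \<in> points UNIV" "\<not> Q \<subseteq> S"
  shows "real (card {T \<in> subspaces_of_dim scale k. Q \<subseteq> T \<and> dim (T \<inter> W) = 0 \<and> dim (T \<inter> S) \<noteq> 0})
    \<le> br (dim S) * ext_count k (dim W) 2"
proof -
  let ?G = "subspaces_of_dim scale k"
  let ?D = "\<lambda>Q. {T \<in> ?G. Q \<subseteq> T \<and> dim (T \<inter> W) = 0 \<and> dim (T \<inter> S) \<noteq> 0}"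
  have QQ: "Q \<in> subspaces_of_dim scale 1" "subspace Q" "dim Q = 1"
    using Q by (auto simp: points_def subspaces_of_dim_def)
  have sub: "?D Q \<subseteq> (\<Union>R\<in>points S. {T \<in> ?G. join Q R \<subseteq> T \<and> dim (T \<inter> W) = 0})"
  proof
    fix T assume T: "T \<in> ?D Q"
    then have sT: "subspace T" using subspaces_of_dimD(1)[of T k] by simp
    have "br 0 < br (dim (T \<inter> S))" using T by (intro br_strict_mono) auto
    then have "card (points (T \<inter> S)) \<noteq> 0"
      using card_points[OF subspace_inter[OF sT S]] by (metis br_0 less_irrefl of_nat_0)
    then obtain R where "R \<in> points (T \<inter> S)" by fastforce
    then have "R \<in> points S" "R \<subseteq> T" by (auto simp: points_def)
    then show "T \<in> (\<Union>R\<in>points S. {T \<in> ?G. join Q R \<subseteq> T \<and> dim (T \<inter> W) = 0})"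
      using T sT by (auto simp: join_subset_iff)
  qed
  have each: "real (card {T \<in> ?G. join Q R \<subseteq> T \<and> dim (T \<inter> W) = 0}) \<le> ext_count k (dim W) 2"
    if R: "R \<in> points S" for R
  proof (cases "dim (join Q R \<inter> W) = 0")
    case True
    have RR: "R \<in> subspaces_of_dim scale 1" "subspace R" "dim R = 1" "R \<subseteq> S"
      using R by (auto simp: points_def subspaces_of_dim_def)
    have "\<not> R \<subseteq> Q" using subspace_dim_equal[of R Q] QQ RR Q by auto
    then have "dim (join Q R) = 2" using dim_join_point[OF RR(1) QQ(2)] QQ by simp
    then show ?thesis using card_extensions_disjoint[OF W, of "join Q R" k] True by simp
  next
    case False
    have "\<not> (join Q R \<subseteq> T \<and> dim (T \<inter> W) = 0)" for T
    proof
      assume T: "join Q R \<subseteq> T \<and> dim (T \<inter> W) = 0"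
      then have "dim (join Q R \<inter> W) \<le> dim (T \<inter> W)" by (intro dim_subset) blast
      then show False using T False by simp
    qed
    then have none: "{T \<in> ?G. join Q R \<subseteq> T \<and> dim (T \<inter> W) = 0} = {}" by simp
    show ?thesis unfolding none using ext_count_nonneg[OF k] by simp
  qed
  have "card (?D Q) \<le> (\<Sum>R\<in>points S. card {T \<in> ?G. join Q R \<subseteq> T \<and> dim (T \<inter> W) = 0})"
    by (rule order_trans[OF card_mono[OF _ sub] card_UN_le]) auto
  then have "real (card (?D Q)) \<le> (\<Sum>R\<in>points S. real (card {T \<in> ?G. join Q R \<subseteq> T \<and> dim (T \<inter> W) = 0}))"
    unfolding of_nat_sum[symmetric] of_nat_le_iff .
  also have "\<dots> \<le> (\<Sum>R\<in>points S. ext_count k (dim W) 2)" using each by (rule sum_mono)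
  finally show ?thesis using card_points[OF S] by simp
qed

text \<open>The constant is \<open>ext_count k (dim W) 1\<close> minus that of
  \<open>card_extensions_disjoint2\<close>; its bounds are read off from any admissible
  \<open>Q\<close>.\<close>

lemma card_extensions_meeting:
  assumes W: "subspace W" and S: "subspace S" and WS: "dim (W \<inter> S) = 0" "dim W + dim S = dimension"
    and k: "dim W + k \<le> dimension"
  shows "\<exists>c. 0 \<le> c \<and> c \<le> br (dim S) * ext_count k (dim W) 2 \<and>
    (\<forall>Q\<in>points UNIV. \<not> Q \<subseteq> W \<longrightarrow> \<not> Q \<subseteq> S \<longrightarrow>
    real (card {T \<in> subspaces_of_dim scale k. Q \<subseteq> T \<and> dim (T \<inter> W) = 0 \<and> dim (T \<inter> S) \<noteq> 0}) = c)"
proof -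
  let ?G = "subspaces_of_dim scale k"
  let ?D = "\<lambda>Q. {T \<in> ?G. Q \<subseteq> T \<and> dim (T \<inter> W) = 0 \<and> dim (T \<inter> S) \<noteq> 0}"
  from card_extensions_disjoint2[OF assms(1-4), of k]
  obtain c where c: "\<forall>Q\<in>points UNIV. \<not> Q \<subseteq> W \<longrightarrow> \<not> Q \<subseteq> S \<longrightarrow>
    real (card {T \<in> ?G. Q \<subseteq> T \<and> dim (T \<inter> W) = 0 \<and> dim (T \<inter> S) = 0}) = c" ..
  have c': "real (card (?D Q)) = ext_count k (dim W) 1 - c"
    if Q: "Q \<in> points UNIV" "\<not> Q \<subseteq> W" "\<not> Q \<subseteq> S" for Q
  proof -
    have QQ: "Q \<in> subspaces_of_dim scale 1" "subspace Q" "dim Q = 1"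
      using Q by (auto simp: points_def subspaces_of_dim_def)
    let ?D' = "{T \<in> ?G. Q \<subseteq> T \<and> dim (T \<inter> W) = 0 \<and> dim (T \<inter> S) = 0}"
    have "{T \<in> ?G. Q \<subseteq> T \<and> dim (T \<inter> W) = 0} = ?D Q \<union> ?D'" by auto
    moreover have "card (?D Q \<union> ?D') = card (?D Q) + card ?D'"
      by (rule card_Un_disjoint[OF finite_space_sets finite_space_sets]) auto
    ultimately have "card {T \<in> ?G. Q \<subseteq> T \<and> dim (T \<inter> W) = 0} = card (?D Q) + card ?D'" by simp
    then show ?thesis
      using c[rule_format, OF Q] card_extensions_disjoint[OF W QQ(2), of k] point_Int[OF QQ(1) W Q(2)] QQ
      by (simp add: Int_commute)
  qed
  have bound: "real (card (?D Q)) \<le> br (dim S) * ext_count k (dim W) 2"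
    if Q: "Q \<in> points UNIV" "\<not> Q \<subseteq> S" for Q
    by (rule card_extensions_meeting_le[OF W S k Q])
  show ?thesis
  proof (cases "\<exists>Q\<in>points UNIV. \<not> Q \<subseteq> W \<and> \<not> Q \<subseteq> S")
    case True
    then obtain Q where Q: "Q \<in> points UNIV" "\<not> Q \<subseteq> W" "\<not> Q \<subseteq> S" by blast
    have "0 \<le> ext_count k (dim W) 1 - c \<and> ext_count k (dim W) 1 - c \<le> br (dim S) * ext_count k (dim W) 2"
      using bound[OF Q(1,3)] unfolding c'[OF Q, symmetric] by simp
    then show ?thesis using c' by (intro exI[of _ "ext_count k (dim W) 1 - c"]) simp
  next
    case False
    \<comment> \<open>Without an admissible \<open>Q\<close> the last clause is vacuous, and 0
      satisfies the bounds.\<close>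
    then show ?thesis using br_nonneg[of "dim S"] ext_count_nonneg[OF k, of 2] by (intro exI[of _ 0]) auto
  qed
qed

text \<open>An averaging argument: the \<open>d\<close>-spaces through \<open>U\<close> have a
  positive multiple of the weight of \<open>U\<close> as their total weight.\<close>

lemma negative_extension:
  assumes U: "subspace U" "weight scale f U < 0" and f: "sum f (points UNIV) = 0"
    and d: "dim U \<le> d" "d < dimension"
  shows "\<exists>W\<in>subspaces_of_dim scale d. U \<subseteq> W \<and> weight scale f W < 0"
proof (rule ccontr)
  assume "\<not> ?thesis"
  then have "0 \<le> (\<Sum>W | W \<in> subspaces_of_dim scale d \<and> U \<subseteq> W. weight scale f W)"
    by (intro sum_nonneg) (auto simp: not_less)
  moreover have "(ext_count d 0 (dim U) - ext_count d 0 (Suc (dim U))) * weight scale f U < 0"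
    using ext_count_less[OF d(2,1)] U by (intro mult_pos_neg) auto
  ultimately show False using sum_weight_extensions[OF U(1) f, of d] by simp
qed

text \<open>A complement \<open>S\<close> of \<open>W\<close> of largest weight dominates the weights of all complements, while the
  complements of \<open>W\<close> meeting \<open>S\<close> together have a large multiple of the weight of \<open>S\<close>. Hence many of
  them must have nonnegative weight.\<close>

lemma many_nonneg_complements:
  assumes W: "subspace W" "weight scale f W < 0" and f: "sum f (points UNIV) = 0"
    and k: "dim W + k = dimension" "1 \<le> k"
  shows "ext_count k (dim W) 1 - br k * ext_count k (dim W) 2
    \<le> real (card {T \<in> nonneg_subspaces scale f k. dim (T \<inter> W) = 0})"
proof -
  define C where "C = {T \<in> subspaces_of_dim scale k. dim (T \<inter> W) = 0}"
  let ?w = "weight scale f"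
  define c1 where "c1 = ext_count k (dim W) 1"
  have c1: "0 < c1" unfolding c1_def using k by (intro ext_count_pos) auto
  have "(\<Sum>T\<in>C. ?w T) = c1 * - ?w W"
    using sum_weight_disjoint[OF W(1) f, of k] by (simp add: C_def c1_def)
  then have pos: "0 < (\<Sum>T\<in>C. ?w T)" using mult_pos_pos[OF c1, of "- ?w W"] W by simp
  then have "C \<noteq> {}" by auto
  then have "Max (?w ` C) \<in> ?w ` C" by (intro Max_in) auto
  then obtain S where "S \<in> C" "?w S = Max (?w ` C)" by auto
  then have S: "S \<in> C" "\<And>T. T \<in> C \<Longrightarrow> ?w T \<le> ?w S" by (auto intro: Max_ge)
  have wS: "0 < ?w S"
  proof (rule ccontr)
    assume "\<not> ?thesis"
    then have "(\<Sum>T\<in>C. ?w T) \<le> 0" using S(2) by (intro sum_nonpos) force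
    then show False using pos by simp
  qed
  have SS: "subspace S" "dim S = k" "dim (S \<inter> W) = 0"
    using S(1) by (auto simp: C_def subspaces_of_dim_def)
  define X where "X = {T \<in> C. dim (T \<inter> S) \<noteq> 0}"
  obtain c2 where c2: "0 \<le> c2" "c2 \<le> br k * ext_count k (dim W) 2"
    "\<And>Q. Q \<in> points UNIV \<Longrightarrow> \<not> Q \<subseteq> W \<Longrightarrow> \<not> Q \<subseteq> S \<Longrightarrow>
    real (card {T \<in> subspaces_of_dim scale k. Q \<subseteq> T \<and> dim (T \<inter> W) = 0 \<and> dim (T \<inter> S) \<noteq> 0}) = c2"
    using card_extensions_meeting[OF W(1) SS(1), of k] SS k by (auto simp: Int_commute)
  \<comment> \<open>Every complement through a point of \<open>S\<close> meets \<open>S\<close>,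
    which gives \<open>c1\<close> there. Splitting the count into a part governed by
    \<open>W\<close> and a part governed by \<open>S\<close> makes \<open>sum_points_split\<close>
    applicable to each.\<close>
  have c: "real (card {T \<in> X. Q \<subseteq> T})
      = (if Q \<subseteq> W then 0 else c2) + (if Q \<subseteq> S then c1 - c2 else 0)"
    if Q: "Q \<in> points UNIV" for Q
  proof -
    have QQ: "Q \<in> subspaces_of_dim scale 1" "subspace Q" "dim Q = 1"
      using Q by (auto simp: points_def subspaces_of_dim_def)
    have not_both: False if "Q \<subseteq> S" "Q \<subseteq> W"
      using dim_subset[of Q "S \<inter> W"] that SS QQ by auto
    have eq: "{T \<in> X. Q \<subseteq> T} = {T \<in> subspaces_of_dim scale k. Q \<subseteq> T \<and> dim (T \<inter> W) = 0 \<and> dim (T \<inter> S) \<noteq> 0}"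
      by (auto simp: X_def C_def)
    consider "Q \<subseteq> W" | "\<not> Q \<subseteq> W" "Q \<subseteq> S" | "\<not> Q \<subseteq> W" "\<not> Q \<subseteq> S" by blast
    then show ?thesis
    proof cases
      case 1
      then have "\<not> Q \<subseteq> T" if "T \<in> X" for T
        using dim_subset[of Q "T \<inter> W"] that QQ by (auto simp: X_def C_def)
      then have "{T \<in> X. Q \<subseteq> T} = {}" by blast
      moreover have "\<not> Q \<subseteq> S" using 1 not_both by blast
      ultimately show ?thesis using 1 by simp
    next
      case 2
      then have "dim (T \<inter> S) \<noteq> 0" if "Q \<subseteq> T" for T
        using dim_subset[of Q "T \<inter> S"] that QQ by auto
      then have "{T \<in> X. Q \<subseteq> T} = {T \<in> subspaces_of_dim scale k. Q \<subseteq> T \<and> dim (T \<inter> W) = 0}"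
        unfolding X_def C_def by blast
      then show ?thesis
        using 2 card_extensions_disjoint[OF W(1) QQ(2), of k] point_Int[OF QQ(1) W(1)] QQ
        by (simp add: c1_def Int_commute)
    next
      case 3
      then show ?thesis unfolding eq using c2(3)[OF Q] by simp
    qed
  qed
  have "(\<Sum>T\<in>X. ?w T) = (\<Sum>Q\<in>points UNIV. f Q * (if Q \<subseteq> W then 0 else c2))
      + (\<Sum>Q\<in>points UNIV. f Q * (if Q \<subseteq> S then c1 - c2 else 0))"
    unfolding sum_weight sum.distrib[symmetric] by (intro sum.cong refl) (simp only: c distrib_left)
  also have "\<dots> = - (c2 * ?w W) + (c1 - c2) * ?w S"
    using W(1) SS(1) f by (simp add: sum_points_split)
  \<comment> \<open>The term with \<open>?w W\<close> is nonnegative, since \<open>?w W < 0\<close>,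
    and is dropped.\<close>
  finally have "(c1 - c2) * ?w S \<le> (\<Sum>T\<in>X. ?w T)"
    using mult_nonneg_nonpos[of c2 "?w W"] c2 W by simp
  also have "\<dots> = (\<Sum>T\<in>{T \<in> X. 0 \<le> ?w T}. ?w T) + (\<Sum>T\<in>{T \<in> X. \<not> 0 \<le> ?w T}. ?w T)"
    by (subst sum.union_disjoint[symmetric]) (auto intro: sum.cong)
  also have "\<dots> \<le> (\<Sum>T\<in>{T \<in> X. 0 \<le> ?w T}. ?w S) + 0"
    by (intro add_mono sum_mono sum_nonpos) (auto simp: X_def S(2))
  also have "\<dots> = real (card {T \<in> X. 0 \<le> ?w T}) * ?w S" by simp
  finally have "c1 - c2 \<le> real (card {T \<in> X. 0 \<le> ?w T})" using wS by simp
  also have "\<dots> \<le> real (card {T \<in> nonneg_subspaces scale f k. dim (T \<inter> W) = 0})"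
    unfolding of_nat_le_iff by (intro card_mono) (auto simp: X_def C_def nonneg_subspaces_def)
  finally show ?thesis using c2 by (simp add: c1_def)
qed

text \<open>The negative space \<open>U\<close> through \<open>P\<close> grows to a negative
  \<open>W\<close> of dimension \<open>dimension - k\<close>. A complement of \<open>W\<close>
  cannot contain \<open>P\<close>, which lies in \<open>W\<close>.\<close>

lemma many_nonneg_avoiding:
  assumes P: "P \<in> points UNIV" and U: "U \<in> subspaces_of_dim scale k" "P \<subseteq> U" "weight scale f U < 0"
    and f: "sum f (points UNIV) = 0" and k: "1 \<le> k" "2 * k \<le> dimension"
  shows "ext_count k (dimension - k) 1 - br k * ext_count k (dimension - k) 2
    \<le> real (card {T \<in> nonneg_subspaces scale f k. \<not> P \<subseteq> T})"
proof -
  obtain W where W: "W \<in> subspaces_of_dim scale (dimension - k)" "U \<subseteq> W" "weight scale f W < 0"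
  proof -
    have "dim U \<le> dimension - k" "dimension - k < dimension"
      using subspaces_of_dimD[OF U(1)] k by linarith+
    then show ?thesis
      using negative_extension[OF _ U(3) f] subspaces_of_dimD[OF U(1)] that by blast
  qed
  note WW = subspaces_of_dimD[OF W(1)]
  have "\<not> P \<subseteq> T" if "dim (T \<inter> W) = 0" for T
    using dim_subset[of P "T \<inter> W"] that U W P by (auto simp: points_def subspaces_of_dim_def)
  then have "card {T \<in> nonneg_subspaces scale f k. dim (T \<inter> W) = 0}
      \<le> card {T \<in> nonneg_subspaces scale f k. \<not> P \<subseteq> T}"
    by (intro card_mono) auto
  then show ?thesis
    using many_nonneg_complements[OF WW(1) W(3) f, of k] WW k by simp
qed

subsection \<open>The key inequality\<close>

text \<open>For an integer \<open>j\<close> one has \<open>j \<le> 1 + j * (j - 1) / 2\<close>.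
  Summed over all \<open>k\<close>-spaces, \<open>j * (j - 1)\<close> counts ordered pairs of
  distinct points of \<open>S\<close>, each pair \<open>ext_count k 0 2\<close> times. The sums are
  obtained as weights for the indicator \<open>g\<close> of the points of \<open>S\<close>.\<close>

lemma sum_card_points_Int_le:
  assumes S: "subspace S" and k: "k \<le> dimension" and Y: "Y \<subseteq> subspaces_of_dim scale k"
  shows "(\<Sum>T\<in>Y. real (card (points (T \<inter> S))))
    \<le> real (card Y) + ext_count k 0 2 * br (dim S) * (br (dim S) - 1) / 2"
proof -
  define g :: "'b set \<Rightarrow> real" where "g P = (if P \<subseteq> S then 1 else 0)" for P
  let ?G = "subspaces_of_dim scale k" and ?b = "br (dim S)"
  define j where "j T = real (card (points (T \<inter> S)))" for T
  have pS: "points UNIV \<inter> {P. P \<subseteq> S} = points S" by (auto simp: points_def)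
  have j: "weight scale g T = j T" for T
  proof -
    have "points T \<inter> {P. P \<subseteq> S} = points (T \<inter> S)" by (auto simp: points_def)
    then show ?thesis by (simp add: weight_eq g_def j_def sum.If_cases)
  qed
  have sg: "sum g (points UNIV) = ?b" "(\<Sum>P\<in>points UNIV. (g P)\<^sup>2) = ?b"
    using card_points[OF S] by (simp_all add: g_def sum.If_cases pS if_distrib[of "\<lambda>x. x\<^sup>2"])
  have "(\<Sum>T\<in>?G. j T) = (\<Sum>P\<in>points UNIV. g P * real (card {T \<in> ?G. P \<subseteq> T}))"
    using sum_weight[of g ?G] by (simp add: j)
  also have "\<dots> = (\<Sum>P\<in>points UNIV. g P * ext_count k 0 1)"
    using card_extensions[of _ k] by (intro sum.cong) (auto simp: points_def subspaces_of_dim_def)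
  finally have sj: "(\<Sum>T\<in>?G. j T) = ?b * ext_count k 0 1"
    by (simp add: sum_distrib_right[symmetric] sg)
  have sj2: "(\<Sum>T\<in>?G. (j T)\<^sup>2) = (ext_count k 0 1 - ext_count k 0 2) * ?b + ext_count k 0 2 * ?b\<^sup>2"
    using sum_weight_squares[where f = g and k = k] by (simp add: j sg)
  have jj: "0 \<le> j T * (j T - 1)" for T by (cases "card (points (T \<inter> S))") (auto simp: j_def)
  have "(\<Sum>T\<in>Y. j T) \<le> (\<Sum>T\<in>Y. 1 + j T * (j T - 1) / 2)"
  proof (rule sum_mono)
    fix T
    have "0 \<le> (j T - 1) * (j T - 2)"
    proof -
      consider "card (points (T \<inter> S)) = 0" | "card (points (T \<inter> S)) = 1" | "2 \<le> card (points (T \<inter> S))"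
        by linarith
      then show ?thesis by cases (auto simp: j_def)
    qed
    then show "j T \<le> 1 + j T * (j T - 1) / 2" by (simp add: field_simps)
  qed
  also have "\<dots> = real (card Y) + (\<Sum>T\<in>Y. j T * (j T - 1)) / 2"
    by (simp add: sum.distrib sum_divide_distrib)
  also have "\<dots> \<le> real (card Y) + (\<Sum>T\<in>?G. j T * (j T - 1)) / 2"
    using sum_mono2[OF _ Y, of "\<lambda>T. j T * (j T - 1)"] jj by simp
  also have "(\<Sum>T\<in>?G. j T * (j T - 1)) = (\<Sum>T\<in>?G. (j T)\<^sup>2) - (\<Sum>T\<in>?G. j T)"
    by (simp add: right_diff_distrib sum_subtractf power2_eq_square)
  also have "\<dots> = ext_count k 0 2 * ?b * (?b - 1)"
    unfolding sj sj2 by (simp add: power2_eq_square algebra_simps)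
  finally show ?thesis by (simp add: j_def)
qed

lemma nonneg_subspaces_subset: "nonneg_subspaces scale f k \<subseteq> subspaces_of_dim scale k"
  by (auto simp: nonneg_subspaces_def)

lemma sum_squares_le:
  assumes f: "sum f (points UNIV) = 0" and k: "2 * k \<le> dimension" "1 \<le> k"
    and max: "\<And>T. T \<in> subspaces_of_dim scale k \<Longrightarrow> weight scale f T \<le> 1"
    and few: "real (card (nonneg_subspaces scale f k)) \<le> ext_count k 0 1"
  defines "M \<equiv> ext_count k 0 1" and "L \<equiv> ext_count k k 1"
  shows "(M - ext_count k 0 2) * (\<Sum>P\<in>points UNIV. (f P)\<^sup>2) \<le> (1 + M / L) * M"
proof -
  let ?G = "subspaces_of_dim scale k" and ?w = "weight scale f"
  define Y where "Y = nonneg_subspaces scale f k"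
  have Y: "Y \<subseteq> ?G" by (simp add: Y_def nonneg_subspaces_subset)
  have L: "0 < L" unfolding L_def using k by (intro ext_count_pos) auto
  have Yw: "0 \<le> ?w T" if "T \<in> Y" for T using that by (simp add: Y_def nonneg_subspaces_def)
  have Gw: "?w T < 0" if "T \<in> ?G - Y" for T using that by (auto simp: Y_def nonneg_subspaces_def)
  have Z: "(\<Sum>T\<in>Y. ?w T) \<le> M"
  proof -
    have "(\<Sum>T\<in>Y. ?w T) \<le> (\<Sum>T\<in>Y. 1)" using max Y by (intro sum_mono) auto
    then show ?thesis using few by (simp add: M_def Y_def)
  qed
  \<comment> \<open>\<open>L * - ?w U\<close> is the total weight of the \<open>k\<close>-spaces
    disjoint from \<open>U\<close>, which is at most the total over \<open>Y\<close>.\<close>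
  have low: "- ?w U \<le> M / L" if "U \<in> ?G" for U
  proof -
    have U: "subspace U" "dim U = k" using subspaces_of_dimD[OF that] by auto
    let ?D = "{T. T \<in> ?G \<and> dim (T \<inter> U) = 0}"
    have "L * - ?w U = (\<Sum>T\<in>?D. ?w T)" using sum_weight_disjoint[OF U(1) f, of k] U by (simp add: L_def)
    also have "\<dots> \<le> (\<Sum>T\<in>?D \<inter> Y. ?w T)"
    proof -
      have "(\<Sum>T\<in>?D. ?w T) = (\<Sum>T\<in>?D \<inter> Y. ?w T) + (\<Sum>T\<in>?D - Y. ?w T)"
        by (rule sum.Int_Diff) simp
      moreover have "(\<Sum>T\<in>?D - Y. ?w T) \<le> 0" by (rule sum_nonpos) (use Gw in force)
      ultimately show ?thesis by simp
    qed
    also have "\<dots> \<le> (\<Sum>T\<in>Y. ?w T)" using Yw by (intro sum_mono2) auto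
    finally show ?thesis using Z L by (simp add: pos_le_divide_eq mult.commute)
  qed
  have ratio: "0 \<le> M / L" using L ext_count_nonneg[of 0 k 1] k by (simp add: M_def)
  have neg: "(\<Sum>T\<in>?G - Y. - ?w T) = (\<Sum>T\<in>Y. ?w T)"
    using sum_weight_all[OF f, of k] sum.subset_diff[OF Y finite_space_sets, of ?w] by (simp add: sum_negf)
  have "(\<Sum>T\<in>?G. (?w T)\<^sup>2) = (\<Sum>T\<in>?G - Y. (?w T)\<^sup>2) + (\<Sum>T\<in>Y. (?w T)\<^sup>2)"
    by (rule sum.subset_diff[OF Y finite_space_sets])
  \<comment> \<open>Squares become linear by \<open>- M / L \<le> ?w T\<close> on the negative
    spaces and \<open>?w T \<le> 1\<close> on \<open>Y\<close>; the two linear totals agree by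
    \<open>neg\<close>.\<close>
  also have "\<dots> \<le> (\<Sum>T\<in>?G - Y. M / L * - ?w T) + (\<Sum>T\<in>Y. ?w T)"
  proof (intro add_mono sum_mono)
    fix T assume T: "T \<in> ?G - Y"
    have "- ?w T * - ?w T \<le> M / L * - ?w T"
      using low[of T] Gw[OF T] T by (intro mult_right_mono) auto
    then show "(?w T)\<^sup>2 \<le> M / L * - ?w T" by (simp add: power2_eq_square)
  next
    fix T assume T: "T \<in> Y"
    then show "(?w T)\<^sup>2 \<le> ?w T"
      using max[of T] Yw[OF T] Y by (auto simp: power2_eq_square intro: mult_left_le)
  qed
  also have "\<dots> = (1 + M / L) * (\<Sum>T\<in>Y. ?w T)"
    unfolding sum_distrib_left[symmetric] neg by (simp add: algebra_simps)
  also have "\<dots> \<le> (1 + M / L) * M" using Z ratio by (intro mult_left_mono) auto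
  finally show ?thesis using f by (simp add: sum_weight_squares M_def)
qed

text \<open>At least \<open>h * M\<close> nonnegative spaces avoid any given point, and
  \<open>c * M\<close> is the number of pairs of a point of \<open>S\<close> and a nonnegative space
  through it. The bound \<open>c \<le> br k\<close> serves large \<open>q\<close>, the bound by
  counting pairs of points serves small \<open>q\<close>.\<close>

lemma key_inequality:
  assumes f: "sum f (points UNIV) = 0" and k: "2 * k < dimension" "2 \<le> k"
    and max: "\<And>T. T \<in> subspaces_of_dim scale k \<Longrightarrow> weight scale f T \<le> 1"
    and S: "S \<in> subspaces_of_dim scale k" "weight scale f S = 1"
    and few: "real (card (nonneg_subspaces scale f k)) \<le> ext_count k 0 1"
    and no_star: "\<And>P. P \<in> points UNIV \<Longrightarrow> \<exists>U\<in>subspaces_of_dim scale k. P \<subseteq> U \<and> weight scale f U < 0"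
    and h: "0 < h" "h * ext_count k 0 1
      \<le> ext_count k (dimension - k) 1 - br k * ext_count k (dimension - k) 2"
  defines "M \<equiv> ext_count k 0 1" and "m \<equiv> ext_count k 0 2" and "L \<equiv> ext_count k k 1"
  shows "\<exists>c. c \<le> br k \<and> c \<le> 1 + br k * (br k - 1) * m / (2 * M) \<and>
    L\<^sup>2 / M \<le> q * m * ((1 + M / L) * M / (M - m)) * (br k + c / h)"
proof -
  let ?G = "subspaces_of_dim scale k" and ?w = "weight scale f"
  define Y where "Y = nonneg_subspaces scale f k"
  define F where "F = (\<Sum>P\<in>points UNIV. (f P)\<^sup>2)"
  define d where "d P = real (card {T \<in> Y. P \<subseteq> T})" for P
  define s where "s P = (\<Sum>T | T \<in> Y \<and> P \<subseteq> T. (?w T)\<^sup>2)" for P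
  define c where "c = (\<Sum>P\<in>points S. d P) / M"
  have SS: "subspace S" "dim S = k" using subspaces_of_dimD[OF S(1)] by auto
  have kn: "k < dimension" using k by simp
  have M: "0 < M" unfolding M_def using k by (intro ext_count_pos) auto
  have m: "0 < m" unfolding m_def using k by (intro ext_count_pos) auto
  have mM: "m < M" using ext_count_less[OF kn, of 1] k by (simp add: M_def m_def numeral_2_eq_2)
  have L: "0 < L" unfolding L_def using k by (intro ext_count_pos) auto
  have Yw: "0 \<le> ?w T" if "T \<in> Y" for T using that by (simp add: Y_def nonneg_subspaces_def)
  have cY: "real (card Y) \<le> M" using few by (simp add: Y_def M_def)
  have cS: "real (card (points S)) = br k" using card_points[OF SS(1)] SS by simp
  have PS: "P \<in> points UNIV" if "P \<in> points S" for P using that by (simp add: points_def)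
  have F: "F \<le> (1 + M / L) * M / (M - m)"
    using sum_squares_le[OF f _ _ max few] k mM
    by (simp add: pos_le_divide_eq F_def M_def m_def L_def mult.commute)
  have F0: "0 \<le> F" by (simp add: F_def sum_nonneg)
  have d: "d P \<le> (1 - h) * M" if P: "P \<in> points UNIV" for P
  proof -
    obtain U where U: "U \<in> ?G" "P \<subseteq> U" "?w U < 0" using no_star[OF P] by blast
    have "h * M \<le> real (card {T \<in> Y. \<not> P \<subseteq> T})"
      using many_nonneg_avoiding[OF P U f] h(2) k by (simp add: Y_def M_def)
    moreover have "card Y = card {T \<in> Y. P \<subseteq> T} + card {T \<in> Y. \<not> P \<subseteq> T}"
      by (subst card_Un_disjoint[symmetric]) (auto intro: arg_cong[where f = card])
    ultimately show ?thesis using cY by (simp add: d_def algebra_simps)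
  qed
  have s0: "0 \<le> s P" for P by (simp add: s_def sum_nonneg)
  \<comment> \<open>Two rounds: \<open>d P \<le> (1 - h) * M\<close> first yields the crude bound
    \<open>q * m * F / h\<close>, which is then inserted only into the term
    \<open>d P * s P\<close>. So \<open>1 / h\<close> is weighted by \<open>d P / M\<close>, and
    summing over \<open>S\<close> produces \<open>c / h\<close> instead of
    \<open>br k / h\<close>.\<close>
  have s: "s P \<le> q * m * F + d P / M * (q * m * F / h)" if P: "P \<in> points UNIV" for P
  proof -
    have 1: "M * s P \<le> M * (q * m * F) + d P * s P"
      using nonneg_squares_through_point[OF kn k(2) P f]
      by (simp add: s_def d_def Y_def M_def m_def F_def)
    also have "\<dots> \<le> M * (q * m * F) + (1 - h) * M * s P"
      using d[OF P] s0 by (intro add_left_mono mult_right_mono)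
    finally have "M * (h * s P) \<le> M * (q * m * F)" by (simp add: algebra_simps)
    then have "s P \<le> q * m * F / h" using M h(1) by (simp add: pos_le_divide_eq mult.commute)
    then have "d P * s P \<le> d P * (q * m * F / h)" by (intro mult_left_mono) (auto simp: d_def)
    then have "M * s P \<le> M * (q * m * F + d P / M * (q * m * F / h))"
      using 1 M by (simp add: distrib_left)
    then show ?thesis using M by simp
  qed
  \<comment> \<open>As \<open>S\<close> has weight 1, the \<open>k\<close>-spaces meeting it have
    total weight \<open>L\<close>. Negative ones are dropped and Cauchy-Schwarz is applied to at
    most \<open>M\<close> remaining spaces.\<close>
  have "L\<^sup>2 / M \<le> (\<Sum>P\<in>points S. s P)"
  proof -
    define Y' where "Y' = {T \<in> Y. dim (T \<inter> S) \<noteq> 0}"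
    have "L = (\<Sum>T | T \<in> ?G \<and> dim (T \<inter> S) \<noteq> 0. ?w T)"
      using sum_weight_meeting[OF SS(1) f, of k] SS S by (simp add: L_def)
    also have "\<dots> = (\<Sum>T\<in>Y'. ?w T) + (\<Sum>T\<in>{T. T \<in> ?G \<and> dim (T \<inter> S) \<noteq> 0} - Y'. ?w T)"
      by (subst sum.subset_diff[of Y']) (auto simp: Y'_def Y_def nonneg_subspaces_def)
    also have "\<dots> \<le> (\<Sum>T\<in>Y'. ?w T) + 0"
      by (intro add_left_mono sum_nonpos) (auto simp: Y'_def Y_def nonneg_subspaces_def)
    finally have "L\<^sup>2 \<le> (\<Sum>T\<in>Y'. ?w T)\<^sup>2" using L by (intro power_mono) auto
    also have "\<dots> \<le> real (card Y') * (\<Sum>T\<in>Y'. (?w T)\<^sup>2)"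
      using sum_squared_le_sum_of_squares[of ?w Y'] by (simp add: mult.commute)
    also have "\<dots> \<le> M * (\<Sum>T\<in>Y'. (?w T)\<^sup>2)"
    proof (intro mult_right_mono sum_nonneg)
      have "card Y' \<le> card Y" by (intro card_mono) (auto simp: Y'_def)
      then show "real (card Y') \<le> M" using cY by simp
    qed simp
    \<comment> \<open>A space meeting \<open>S\<close> contains at least one point of
      \<open>S\<close>, so weighting by the number of such points only increases the sum.\<close>
    also have "(\<Sum>T\<in>Y'. (?w T)\<^sup>2) \<le> (\<Sum>T\<in>Y. real (card (points (T \<inter> S))) * (?w T)\<^sup>2)"
    proof -
      have "(\<Sum>T\<in>Y'. 1 * (?w T)\<^sup>2) \<le> (\<Sum>T\<in>Y'. real (card (points (T \<inter> S))) * (?w T)\<^sup>2)"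
      proof (intro sum_mono mult_right_mono)
        fix T assume T: "T \<in> Y'"
        then have "subspace (T \<inter> S)"
          using SS by (auto simp: Y'_def Y_def nonneg_subspaces_def subspaces_of_dim_def subspace_inter)
        moreover have "br 1 \<le> br (dim (T \<inter> S))" using T by (intro br_mono) (auto simp: Y'_def)
        ultimately show "1 \<le> real (card (points (T \<inter> S)))" by (simp add: card_points)
      qed simp
      also have "\<dots> \<le> (\<Sum>T\<in>Y. real (card (points (T \<inter> S))) * (?w T)\<^sup>2)"
        by (intro sum_mono2) (auto simp: Y'_def)
      finally show ?thesis by simp
    qed
    also have "\<dots> = (\<Sum>T\<in>Y. \<Sum>P | P \<in> points S \<and> P \<subseteq> T. (?w T)\<^sup>2)"
      by (intro sum.cong refl) (auto intro!: arg_cong[where f = card] simp: points_def)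
    also have "\<dots> = (\<Sum>P\<in>points S. s P)"
      unfolding s_def by (rule sum.swap_restrict) auto
    finally have "L\<^sup>2 \<le> M * (\<Sum>P\<in>points S. s P)" using M by simp
    then show ?thesis using M by (simp add: pos_divide_le_eq mult.commute)
  qed
  also have "\<dots> \<le> (\<Sum>P\<in>points S. q * m * F + d P / M * (q * m * F / h))"
    using s PS by (intro sum_mono) auto
  also have "\<dots> = q * m * F * (br k + c / h)"
  proof -
    have "(\<Sum>P\<in>points S. d P / M * (q * m * F / h)) = c * (q * m * F / h)"
      by (simp only: c_def sum_divide_distrib sum_distrib_right)
    then show ?thesis by (simp add: sum.distrib cS algebra_simps)
  qed
  also have "\<dots> \<le> q * m * ((1 + M / L) * M / (M - m)) * (br k + c / h)"
  proof -
    have "0 \<le> c" unfolding c_def d_def using M by (intro divide_nonneg_nonneg sum_nonneg) auto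
    then have "0 \<le> br k + c / h" using h br_nonneg[of k] by simp
    then show ?thesis using F q_ge_2 m by (intro mult_right_mono mult_left_mono) auto
  qed
  finally have main: "L\<^sup>2 / M \<le> \<dots>" .
  have "c \<le> br k"
  proof -
    have "d P \<le> M" for P
    proof -
      have "card {T \<in> Y. P \<subseteq> T} \<le> card Y" by (intro card_mono) auto
      then show ?thesis using cY by (simp add: d_def)
    qed
    then have "(\<Sum>P\<in>points S. d P) \<le> (\<Sum>P\<in>points S. M)" by (intro sum_mono) auto
    then show ?thesis using M cS by (simp add: c_def pos_divide_le_eq)
  qed
  moreover have "c \<le> 1 + br k * (br k - 1) * m / (2 * M)"
  proof -
    have "(\<Sum>P\<in>points S. d P) = (\<Sum>P\<in>points S. \<Sum>T | T \<in> Y \<and> P \<subseteq> T. 1)"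
      by (simp add: d_def)
    also have "\<dots> = (\<Sum>T\<in>Y. \<Sum>P | P \<in> points S \<and> P \<subseteq> T. 1)"
      by (rule sum.swap_restrict[symmetric]) auto
    also have "\<dots> = (\<Sum>T\<in>Y. real (card (points (T \<inter> S))))"
      by (intro sum.cong refl) (auto intro!: arg_cong[where f = card] simp: points_def)
    also have "\<dots> \<le> M + m * br k * (br k - 1) / 2"
      using sum_card_points_Int_le[OF SS(1), of k Y] cY kn SS nonneg_subspaces_subset[of f k]
      by (simp add: Y_def m_def)
    finally show ?thesis using M by (simp add: c_def field_simps)
  qed
  ultimately show ?thesis using main by blast
qed

end

subsection \<open>Numerical estimates\<close>

text \<open>The right-hand side tends to the Euler product, whose pentagonal number series starts with
  \<open>1 - x - x\<^sup>2\<close>.\<close>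

lemma prod_one_minus_power_ge:
  fixes x :: real
  assumes "0 \<le> x" "x \<le> 1" "1 \<le> k"
  shows "1 - x - x\<^sup>2 + x ^ Suc k \<le> (\<Prod>i=1..k. 1 - x ^ i)"
  using assms(3)
proof (induction k rule: nat_induct_at_least)
  case base
  then show ?case by (simp add: power2_eq_square)
next
  case (Suc k)
  have "0 \<le> 1 - x ^ Suc k" using assms power_le_one[of x "Suc k"] by simp
  then have "(1 - x - x\<^sup>2 + x ^ Suc k) * (1 - x ^ Suc k) \<le> (\<Prod>i=1..Suc k. 1 - x ^ i)"
    using mult_right_mono[OF Suc.IH] by simp
  \<comment> \<open>The surplus term \<open>x ^ Suc k\<close> in the claim makes the induction
    close: after multiplying out, only the square of this power has to be compared with
    \<open>x\<^sup>2 * x ^ Suc k\<close>.\<close>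
  moreover have "x ^ Suc k * x ^ Suc k \<le> x\<^sup>2 * x ^ Suc k"
    using assms Suc.hyps power_decreasing[of 2 "Suc k" x] by (intro mult_right_mono) auto
  ultimately show ?case by (simp add: algebra_simps power2_eq_square)
qed

text \<open>The key inequality divided by \<open>M\<close>, with \<open>\<mu>\<close> for
  \<open>m / M\<close>, \<open>\<rho>\<close> for \<open>L / M\<close> and \<open>g\<close> for
  \<open>br k\<close>. Its right-hand side is monotone in each quantity, so numerical bounds may be
  substituted.\<close>

lemma key_inequality_numeric:
  fixes q g \<mu> \<rho> c h t u t' c' h' :: real
  assumes "1 - t \<le> \<rho>" "t < 1" "\<mu> \<le> u" "u < 1" "q * \<mu> * g \<le> t'" "q * \<mu> * c \<le> c'" "0 \<le> c'" "0 \<le> t'"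
    and h: "0 < h'" "h' \<le> h"
    and main: "\<rho>\<^sup>2 \<le> q * \<mu> * ((1 + 1 / \<rho>) / (1 - \<mu>)) * (g + c / h)"
  shows "(1 - t)\<^sup>2 \<le> (1 + 1 / (1 - t)) / (1 - u) * (t' + c' / h')"
proof -
  have "0 < \<rho>" using assms by simp
  have "(1 - t)\<^sup>2 \<le> \<rho>\<^sup>2" using assms by (intro power_mono) auto
  also have "\<dots> \<le> (1 + 1 / \<rho>) / (1 - \<mu>) * (q * \<mu> * g + q * \<mu> * c / h)"
  proof -
    have "q * \<mu> * ((1 + 1 / \<rho>) / (1 - \<mu>)) * (g + c / h)
        = (1 + 1 / \<rho>) / (1 - \<mu>) * (q * \<mu> * (g + c / h))" by (simp only: mult_ac)
    then show ?thesis using main by (simp add: distrib_left)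
  qed
  also have "\<dots> \<le> (1 + 1 / \<rho>) / (1 - \<mu>) * (t' + c' / h')"
  proof (intro mult_left_mono add_mono)
    have "q * \<mu> * c / h \<le> c' / h" using assms by (intro divide_right_mono) auto
    also have "\<dots> \<le> c' / h'" using assms by (intro divide_left_mono) auto
    finally show "q * \<mu> * c / h \<le> c' / h'" .
  qed (use assms \<open>0 < \<rho>\<close> in auto)
  also have "\<dots> \<le> (1 + 1 / (1 - t)) / (1 - u) * (t' + c' / h')"
    using assms \<open>0 < \<rho>\<close> by (intro mult_right_mono frac_le add_left_mono divide_left_mono) auto
  finally show ?thesis .
qed

section \<open>Extension counts compared with powers of \<open>q\<close>, and the final
  contradiction\<close>

context finite_field_vector_space
begin

text \<open>For a subspace of complementary dimension every factor of the product equals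
  \<open>q ^ (dimension - k)\<close>.\<close>

lemma ext_count_complement:
  assumes "k \<le> dimension" "j \<le> k"
  shows "ext_count k (dimension - k) j = (q ^ (dimension - k)) ^ (k - j)"
proof -
  have "(br dimension - br (dimension - k + i)) / (br k - br i) = q ^ (dimension - k)"
    if "i < k" for i
  proof -
    have "q ^ i < q ^ k" using that q_ge_2 by (intro power_strict_increasing) auto
    moreover have "q ^ dimension = q ^ (dimension - k) * q ^ k"
      using assms by (simp add: power_add[symmetric])
    ultimately have "br dimension - br (dimension - k + i) = q ^ (dimension - k) * (br k - br i)"
      by (simp add: br_diff power_add right_diff_distrib)
    then show ?thesis using br_strict_mono[OF that] by simp
  qed
  then show ?thesis using assms by (simp add: ext_count_def)
qed

text \<open>Each factor of the star size exceeds \<open>q ^ (dimension - k)\<close> by at most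
  \<open>1 / (1 - (1 / q) ^ (k - i))\<close>; the product of these corrections is estimated by
  \<open>prod_one_minus_power_ge\<close> with \<open>k - 1\<close> factors.\<close>

lemma ext_count_one_le:
  assumes "k \<le> dimension" "2 \<le> k"
  shows "(1 - 1 / q - (1 / q)\<^sup>2 + (1 / q) ^ k) * ext_count k 0 1 \<le> (q ^ (dimension - k)) ^ (k - 1)"
proof -
  define x where "x = 1 / q"
  have x: "0 < x" "x < 1" "x * q = 1" using q_ge_2 by (auto simp: x_def)
  have factor: "(1 - x ^ (k - i)) * ((br dimension - br i) / (br k - br i)) \<le> q ^ (dimension - k)"
    if "i < k" for i
  proof -
    have lt: "q ^ i < q ^ k" using that q_ge_2 by (intro power_strict_increasing) auto
    have "x ^ (k - i) * q ^ k = q ^ i"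
    proof -
      have "q ^ k = q ^ (k - i) * q ^ i" using that by (simp add: power_add[symmetric])
      then have "x ^ (k - i) * q ^ k = (x * q) ^ (k - i) * q ^ i" by (simp add: power_mult_distrib)
      then show ?thesis using x by simp
    qed
    then have e: "1 - x ^ (k - i) = (q ^ k - q ^ i) / q ^ k" using q_ge_2 by (simp add: field_simps)
    have "(1 - x ^ (k - i)) * ((br dimension - br i) / (br k - br i)) = (q ^ dimension - q ^ i) / q ^ k"
      unfolding e br_diff using lt q_ge_2 by simp
    also have "\<dots> \<le> q ^ dimension / q ^ k" using q_ge_2 by (intro divide_right_mono) auto
    also have "\<dots> = q ^ (dimension - k)" using assms q_ge_2 by (simp add: power_diff)
    finally show ?thesis .
  qed
  have M: "0 < ext_count k 0 1" using assms by (intro ext_count_pos) auto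
  have "1 - x - x\<^sup>2 + x ^ Suc (k - 1) \<le> (\<Prod>i=1..k-1. 1 - x ^ i)"
    using x assms by (intro prod_one_minus_power_ge) auto
  also have "\<dots> = (\<Prod>i=1..<k. 1 - x ^ (k - i))"
    by (rule prod.reindex_bij_witness[of _ "\<lambda>i. k - i" "\<lambda>i. k - i"]) auto
  finally have "(1 - x - x\<^sup>2 + x ^ k) * ext_count k 0 1 \<le> (\<Prod>i=1..<k. 1 - x ^ (k - i)) * ext_count k 0 1"
    using M assms by (intro mult_right_mono) auto
  also have "\<dots> = (\<Prod>i=1..<k. (1 - x ^ (k - i)) * ((br dimension - br i) / (br k - br i)))"
    using assms by (simp add: ext_count_def prod.distrib[symmetric])
  also have "\<dots> \<le> (\<Prod>i=1..<k. q ^ (dimension - k))"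
  proof (intro prod_mono conjI)
    fix i assume i: "i \<in> {1..<k}"
    then show "(1 - x ^ (k - i)) * ((br dimension - br i) / (br k - br i)) \<le> q ^ (dimension - k)"
      using factor by simp
    have "x ^ (k - i) \<le> 1" using x by (intro power_le_one) auto
    then show "0 \<le> (1 - x ^ (k - i)) * ((br dimension - br i) / (br k - br i))"
      using br_mono[of i dimension] br_mono[of i k] i assms
      by (intro mult_nonneg_nonneg divide_nonneg_nonneg) auto
  qed
  finally show ?thesis by (simp add: x_def)
qed

text \<open>Proved by counting: take a \<open>k\<close>-space \<open>S\<close> and a point
  \<open>Q\<close> outside it. By a union bound at most \<open>br k * ext_count k 0 2\<close> of the
  \<open>k\<close>-spaces through \<open>Q\<close> meet \<open>S\<close>.\<close>

lemma ext_count_disjoint_ge: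
  assumes "2 * k \<le> dimension" "1 \<le> k"
  shows "ext_count k 0 1 - br k * ext_count k 0 2 \<le> ext_count k k 1"
proof -
  let ?G = "subspaces_of_dim scale k"
  have "real (card {T \<in> ?G. {0} \<subseteq> T}) > 0"
    using card_extensions[of "{0}" k] ext_count_pos[of 0 k 0] assms by simp
  then obtain S where "S \<in> ?G" by (metis (no_types, lifting) card_gt_0_iff of_nat_0_less_iff empty_Collect_eq)
  then have S: "subspace S" "dim S = k" using subspaces_of_dimD by auto
  have "br k < br dimension" using assms by (intro br_strict_mono) auto
  then have "real (card {Q \<in> points UNIV. \<not> Q \<subseteq> S}) \<noteq> 0"
    using card_points_diff[OF subspace_UNIV S(1)] S by (simp add: dimension_def)
  then have "{Q \<in> points UNIV. \<not> Q \<subseteq> S} \<noteq> {}" by force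
  then obtain Q where Q: "Q \<in> points UNIV" "\<not> Q \<subseteq> S" by blast
  then have QQ: "Q \<in> subspaces_of_dim scale 1" "subspace Q" "dim Q = 1"
    by (auto simp: points_def subspaces_of_dim_def)
  have z: "dim (T \<inter> {0}) = 0" for T by (simp add: dim_eq_0)
  have "{T \<in> ?G. Q \<subseteq> T} = {T \<in> ?G. Q \<subseteq> T \<and> dim (T \<inter> S) = 0} \<union> {T \<in> ?G. Q \<subseteq> T \<and> dim (T \<inter> S) \<noteq> 0}"
    by auto
  then have "real (card {T \<in> ?G. Q \<subseteq> T}) \<le> real (card {T \<in> ?G. Q \<subseteq> T \<and> dim (T \<inter> S) = 0})
      + real (card {T \<in> ?G. Q \<subseteq> T \<and> dim (T \<inter> S) \<noteq> 0})"
    by (metis (no_types, lifting) card_Un_le of_nat_add of_nat_le_iff)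
  then show ?thesis
    using card_extensions[OF QQ(2), of k] card_extensions_disjoint[OF S(1) QQ(2), of k]
      card_extensions_meeting_le[of "{0}" S k Q] z point_Int[OF QQ(1) S(1) Q(2)] QQ S Q assms
    by (simp add: Int_commute)
qed

text \<open>The key inequality fails numerically. With \<open>E = q ^ (dimension - k)\<close>, the
  ratio \<open>\<mu>\<close> is at most \<open>1 / E\<close> and \<open>\<rho>\<close> is at least
  \<open>1 - g / E\<close>, so \<open>large\<close> makes the right-hand side too small.\<close>

lemma no_counterexample:
  assumes f: "sum f (points UNIV) = 0" and k: "2 * k < dimension" "2 \<le> k"
    and max: "\<And>T. T \<in> subspaces_of_dim scale k \<Longrightarrow> weight scale f T \<le> 1"
    and S: "S \<in> subspaces_of_dim scale k" "weight scale f S = 1"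
    and few: "real (card (nonneg_subspaces scale f k)) \<le> ext_count k 0 1"
    and no_star: "\<And>P. P \<in> points UNIV \<Longrightarrow> \<exists>U\<in>subspaces_of_dim scale k. P \<subseteq> U \<and> weight scale f U < 0"
    and large: "q \<ge> 32 \<or> 3 * k \<le> dimension"
  shows False
proof -
  define M where "M = ext_count k 0 1"
  define m where "m = ext_count k 0 2"
  define L where "L = ext_count k k 1"
  define E where "E = q ^ (dimension - k)"
  define g where "g = br k"
  define \<mu> where "\<mu> = m / M"
  define \<rho> where "\<rho> = L / M"
  \<comment> \<open>The complement count is bounded below by
    \<open>E ^ (k - 1) * (1 - g / E)\<close>, and \<open>ext_count_one_le\<close> compares
    \<open>E ^ (k - 1)\<close> with \<open>M\<close>.\<close>
  define h where "h = (1 - 1 / q - (1 / q)\<^sup>2 + (1 / q) ^ k) * (1 - g / E)"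
  have q2: "q \<ge> 2" by (rule q_ge_2)
  have M: "0 < M" unfolding M_def using k by (intro ext_count_pos) auto
  have L: "0 < L" unfolding L_def using k by (intro ext_count_pos) auto
  have m: "0 < m" unfolding m_def using k by (intro ext_count_pos) auto
  have \<mu>0: "0 < \<mu>" using M m by (simp add: \<mu>_def)
  have \<rho>: "1 - \<mu> * g \<le> \<rho>"
  proof -
    have "(M - g * m) / M \<le> L / M"
      using ext_count_disjoint_ge[of k] k M
      by (intro divide_right_mono) (simp_all add: M_def m_def L_def g_def)
    then show ?thesis using M by (simp add: \<mu>_def \<rho>_def diff_divide_distrib mult.commute)
  qed
  have E0: "0 < E" using q2 by (simp add: E_def)
  have qn: "q ^ dimension = E * q ^ k" using k by (simp add: E_def power_add[symmetric])
  have E_ge: "q ^ (k + 1) \<le> E" unfolding E_def using k q2 by (intro power_increasing) auto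
  have g_eq: "g * (q - 1) = q ^ k - 1" using q2 by (simp add: g_def br_def)
  \<comment> \<open>The recursion at \<open>j = 1\<close> determines \<open>\<mu>\<close> exactly,
    because \<open>br 1 = 1\<close>.\<close>
  have \<mu>_eq: "\<mu> * (q ^ dimension - q) = q ^ k - q"
  proof -
    have "br d - 1 = (q ^ d - q) / (q - 1)" for d using br_diff[of d 1] by simp
    then have "M * ((q ^ k - q) / (q - 1)) = (q ^ dimension - q) / (q - 1) * m"
      using ext_count_rec[of k 0 1] by (simp add: M_def m_def numeral_2_eq_2)
    then have "M * (q ^ k - q) = (q ^ dimension - q) * m" using q2 by simp
    then show ?thesis using M by (simp add: \<mu>_def field_simps)
  qed
  have "q ^ 1 < q ^ dimension" using k q2 by (intro power_strict_increasing) auto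
  then have qn1: "q < q ^ dimension" by simp
  have \<mu>E: "\<mu> * E \<le> 1"
  proof -
    have E1: "1 \<le> E" using q2 by (simp add: E_def)
    have "\<mu> * E * (q ^ dimension - q) = (q ^ k - q) * E"
      unfolding \<mu>_eq[symmetric] by (simp only: mult_ac)
    also have "\<dots> \<le> 1 * (q ^ dimension - q)" using qn E1 q2 by (simp add: algebra_simps)
    finally show ?thesis using qn1 by simp
  qed
  have \<mu>1: "\<mu> < 1"
  proof -
    have "1 < E" unfolding E_def using q2 k by (intro one_less_power) auto
    then have "\<mu> * 1 < \<mu> * E" using \<mu>0 by (intro mult_strict_left_mono) auto
    then show ?thesis using \<mu>E by simp
  qed
  have g0: "0 < g" using br_strict_mono[of 0 k] k by (simp add: g_def)
  have gE: "g / E < 1"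
  proof -
    have "g * 1 \<le> g * (q - 1)" using g0 q2 by (intro mult_left_mono) auto
    also have "\<dots> < q ^ k" using g_eq by simp
    also have "\<dots> \<le> q ^ (k + 1)" using q2 by (intro power_increasing) auto
    finally show ?thesis using E_ge E0 by simp
  qed
  have x: "1 / q + (1 / q)\<^sup>2 \<le> 3 / 4"
  proof -
    have "1 / q \<le> 1 / 2" using q2 by simp
    moreover from this have "(1 / q)\<^sup>2 \<le> (1 / 2)\<^sup>2" using q2 by (intro power_mono) auto
    ultimately show ?thesis by (simp add: power2_eq_square)
  qed
  have h0: "0 < h"
  proof -
    have "0 < (1 / q) ^ k" using q2 by simp
    then show ?thesis unfolding h_def using x gE by (intro mult_pos_pos) auto
  qed
  have hM: "h * M \<le> ext_count k (dimension - k) 1 - br k * ext_count k (dimension - k) 2"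
  proof -
    have "h * M \<le> E ^ (k - 1) * (1 - g / E)"
      using mult_right_mono[OF ext_count_one_le[of k], of "1 - g / E"] k gE
      by (simp add: h_def M_def E_def mult_ac)
    also have "\<dots> = E ^ (k - 1) - g * E ^ (k - 2)"
    proof -
      have "E ^ (k - 1) = E * E ^ (k - 2)" using k by (simp add: power_Suc[symmetric] Suc_diff_Suc numeral_2_eq_2)
      then show ?thesis using E0 by (simp add: right_diff_distrib)
    qed
    finally show ?thesis using ext_count_complement[of k 1] ext_count_complement[of k 2] k
      by (simp add: E_def g_def)
  qed
  obtain c where c: "c \<le> g" "c \<le> 1 + g * (g - 1) * m / (2 * M)"
    and main: "L\<^sup>2 / M \<le> q * m * ((1 + M / L) * M / (M - m)) * (g + c / h)"
    using key_inequality[OF f k max S few no_star h0 hM[unfolded M_def]]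
    unfolding M_def m_def L_def g_def by blast
  have c2: "c \<le> 1 + g * (g - 1) * \<mu> / 2" using c(2) by (simp add: \<mu>_def)
  have main': "\<rho>\<^sup>2 \<le> q * \<mu> * ((1 + 1 / \<rho>) / (1 - \<mu>)) * (g + c / h)"
  proof -
    have "\<rho>\<^sup>2 = L\<^sup>2 / M / M" by (simp add: \<rho>_def power2_eq_square)
    also have "\<dots> \<le> q * m * ((1 + M / L) * M / (M - m)) * (g + c / h) / M"
      using main M by (intro divide_right_mono) auto
    also have "M / (M - m) = 1 / (1 - \<mu>)" using M by (simp add: \<mu>_def field_simps)
    then have "q * m * ((1 + M / L) * M / (M - m)) * (g + c / h) / M
        = q * \<mu> * ((1 + 1 / \<rho>) / (1 - \<mu>)) * (g + c / h)"
      by (simp add: \<mu>_def \<rho>_def times_divide_eq_right[symmetric] del: times_divide_eq_right)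
    finally show ?thesis .
  qed
  note num = key_inequality_numeric[OF _ _ _ _ _ _ _ _ _ _ main']
  have g_le: "g \<le> q ^ k / (q - 1)" using g_eq q2 by (simp add: pos_le_divide_eq)
  have \<mu>_le: "\<mu> \<le> 1 / E" using \<mu>E E0 by (simp add: pos_le_divide_eq)
  define r where "r = q ^ k / E"
  have r0: "0 < r" using q2 E0 by (simp add: r_def)
  have gE_le: "g / E \<le> r / (q - 1)"
    using divide_right_mono[OF g_le, of E] E0 by (simp add: r_def mult.commute)
  have \<mu>g_le: "\<mu> * g \<le> g / E" using mult_right_mono[OF \<mu>_le, of g] g0 by simp
  have \<rho>_ge: "1 - b \<le> \<rho>" if "g / E \<le> b" for b using \<rho> \<mu>g_le that by linarith
  have h_ge: "a * (1 - b) \<le> h" if "a \<le> 1 - 1 / q - (1 / q)\<^sup>2 + (1 / q) ^ k" "0 \<le> a" "g / E \<le> b" for a b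
  proof -
    have "a * (1 - b) \<le> a * (1 - g / E)" using that by (intro mult_left_mono) auto
    also have "\<dots> \<le> h" unfolding h_def using that gE by (intro mult_right_mono) auto
    finally show ?thesis .
  qed
  have c3: "c \<le> 1 + b / 2" if "g * g * \<mu> \<le> b" for b
  proof -
    have "g * (g - 1) * \<mu> = g * g * \<mu> - g * \<mu>" by (simp add: algebra_simps)
    then show ?thesis using c2 that mult_pos_pos[OF g0 \<mu>0] by linarith
  qed
  have xk: "0 \<le> (1 / q) ^ k" using q2 by simp
  have k_2: "q\<^sup>2 \<le> q ^ k" using q2 k by (intro power_increasing) auto
  show False
  proof (cases "32 \<le> q")
    case True
    \<comment> \<open>From \<open>2 * k < dimension\<close> one has
      \<open>E \<ge> q ^ (k + 1)\<close>. Below, 15/16 is a lower bound for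
      \<open>1 - 1 / 32 - (1 / 32)\<^sup>2\<close>.\<close>
    have "q * r \<le> 1" using E_ge E0 by (simp add: r_def)
    then have r: "r \<le> 1 / q" using q2 by (simp add: pos_le_divide_eq mult.commute)
    also have "\<dots> \<le> 1 / 32" using True by simp
    finally have r32: "r \<le> 1 / 32" .
    have t: "g / E \<le> 1 / 32"
    proof -
      have "r / (q - 1) \<le> r / 1" using r0 True by (intro divide_left_mono) auto
      then show ?thesis using gE_le r32 by linarith
    qed
    have qg: "q * \<mu> * g \<le> 1 / 31"
    proof -
      have "q * (\<mu> * g) \<le> q * (r / (q - 1))" using q2 \<mu>g_le gE_le by (intro mult_left_mono) auto
      also have "\<dots> = q * r / (q - 1)" by (rule times_divide_eq_right)
      also have "\<dots> \<le> 1 / (q - 1)" using \<open>q * r \<le> 1\<close> q2 by (intro divide_right_mono) auto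
      also have "\<dots> \<le> 1 / 31" using True by (intro divide_left_mono) auto
      finally show ?thesis by (simp add: mult.assoc)
    qed
    have "q * \<mu> * c \<le> q * \<mu> * g" using c(1) \<mu>0 q2 by (intro mult_left_mono) auto
    then have qc: "q * \<mu> * c \<le> 1 / 31" using qg by simp
    have x32: "1 / q \<le> 1 / 32" using True by simp
    then have "(1 / q)\<^sup>2 \<le> (1 / 32)\<^sup>2" using q2 by (intro power_mono) auto
    then have hh: "15 / 16 * (1 - 1 / 32) \<le> h"
      using x32 xk by (intro h_ge t) (auto simp: power2_eq_square)
    have u: "\<mu> \<le> 1 / 32"
    proof -
      have "1 \<le> g" using br_mono[of 1 k] k by (simp add: g_def)
      then have "\<mu> \<le> \<mu> * g" using \<mu>0 by simp
      then show ?thesis using \<mu>g_le t by linarith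
    qed
    have "(1 - 1 / 32)\<^sup>2 \<le> (1 + 1 / (1 - 1 / 32)) / (1 - 1 / 32) * (1 / 31 + 1 / 31 / (15 / 16 * (1 - 1 / 32 :: real)))"
      by (rule num[OF \<rho>_ge[OF t] _ u _ qg qc _ _ _ hh]) auto
    then show False by (simp add: power2_eq_square)
  next
    case False
    then have n: "3 * k \<le> dimension" using large by simp
    then have E_ge2: "q ^ k * q ^ k \<le> E"
      unfolding E_def power_add[symmetric] using q2 by (intro power_increasing) auto
    have r: "r \<le> 1 / q ^ k" using E_ge2 E0 q2 by (simp add: r_def field_simps)
    show False
    proof (cases "3 \<le> q")
      case True
      \<comment> \<open>With \<open>q \<ge> 3\<close> and \<open>k \<ge> 2\<close>, the bound
        \<open>E \<ge> q ^ k * q ^ k\<close> yields the constants that follow; 5/9 is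
        \<open>1 - 1 / 3 - 1 / 9\<close>.\<close>
      have q9: "9 \<le> q ^ k"
        by (rule order_trans[OF _ k_2]) (use power_mono[of 3 q 2] True in simp)
      have r9: "r \<le> 1 / 9" using r q9 by (smt (verit) frac_le)
      have t: "g / E \<le> 1 / 18"
      proof -
        have "r / (q - 1) \<le> (1 / 9) / 2" using r9 r0 True by (intro frac_le) auto
        then show ?thesis using gE_le by linarith
      qed
      have "q * r \<le> q * (1 / q ^ k)" using r q2 by (intro mult_left_mono) auto
      also have "\<dots> \<le> q * (1 / q\<^sup>2)" using k_2 q2 by (intro mult_left_mono divide_left_mono) auto
      also have "\<dots> = 1 / q" using q2 by (simp add: power2_eq_square)
      also have "\<dots> \<le> 1 / 3" using True by simp
      finally have qr: "q * r \<le> 1 / 3" .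
      have qg: "q * \<mu> * g \<le> 1 / 6"
      proof -
        have "q * (\<mu> * g) \<le> q * (r / (q - 1))" using q2 \<mu>g_le gE_le by (intro mult_left_mono) auto
        also have "\<dots> = q * r / (q - 1)" by (rule times_divide_eq_right)
        also have "\<dots> \<le> (1 / 3) / 2" using qr True r0 by (intro frac_le) auto
        finally show ?thesis by (simp add: mult.assoc)
      qed
      have "9 * 9 \<le> q ^ k * q ^ k" using q9 q2 by (intro mult_mono) auto
      then have E81: "81 \<le> E" using E_ge2 by linarith
      have u: "\<mu> \<le> 1 / 81" using \<mu>_le E81 by (smt (verit) frac_le)
      have qmu: "q * \<mu> \<le> 1 / 27"
      proof -
        have "q * \<mu> \<le> q * (1 / E)" using \<mu>_le q2 by (intro mult_left_mono) auto
        also have "\<dots> \<le> q * (1 / (9 * q\<^sup>2))"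
        proof -
          have "9 * q\<^sup>2 \<le> q ^ k * q ^ k" using q9 k_2 q2 by (intro mult_mono) auto
          then have "9 * q\<^sup>2 \<le> E" using E_ge2 by linarith
          then show ?thesis using q2 by (intro mult_left_mono frac_le) auto
        qed
        also have "\<dots> = 1 / q / 9" using q2 by (simp add: power2_eq_square)
        also have "\<dots> \<le> 1 / 3 / 9" using True by (intro divide_right_mono divide_left_mono) auto
        finally show ?thesis by simp
      qed
      have "g \<le> q ^ k / 2" using g_le True q2 by (smt (verit) frac_le zero_less_power)
      then have "g * g \<le> (q ^ k / 2) * (q ^ k / 2)" using g0 by (intro mult_mono) auto
      then have "g * g \<le> E / 4" using E_ge2 by simp
      then have "g * g * \<mu> \<le> E / 4 * \<mu>" using \<mu>0 by (intro mult_right_mono) auto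
      then have "g * g * \<mu> \<le> 1 / 4" using \<mu>E by (simp add: mult.commute)
      then have "c \<le> 9 / 8" using c3 by fastforce
      then have "q * \<mu> * c \<le> q * \<mu> * (9 / 8)" using \<mu>0 q2 by (intro mult_left_mono) auto
      also have "\<dots> \<le> 1 / 27 * (9 / 8)" using qmu by (intro mult_right_mono) auto
      finally have qc: "q * \<mu> * c \<le> 1 / 24" by simp
      have x3: "1 / q \<le> 1 / 3" using True by simp
      then have "(1 / q)\<^sup>2 \<le> (1 / 3)\<^sup>2" using q2 by (intro power_mono) auto
      then have hh: "5 / 9 * (1 - 1 / 18) \<le> h"
        using x3 xk by (intro h_ge t) (auto simp: power2_eq_square)
      have "(1 - 1 / 18)\<^sup>2 \<le> (1 + 1 / (1 - 1 / 18)) / (1 - 1 / 81) * (1 / 6 + 1 / 24 / (5 / 9 * (1 - 1 / 18 :: real)))"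
        by (rule num[OF \<rho>_ge[OF t] _ u _ qg qc _ _ _ hh]) auto
      then show False by (simp add: power2_eq_square)
    next
      case False
      have q_2: "q = 2"
      proof -
        have "card (UNIV :: 'a set) < 3" using False by (simp add: q_eq)
        then have "card (UNIV :: 'a set) = 2" using two_le_card_field by linarith
        then show ?thesis by (simp add: q_eq)
      qed
      have g_2: "g = 2 ^ k - 1" using g_eq by (simp add: q_2)
      have x_2: "1 - 1 / q - (1 / q)\<^sup>2 + (1 / q) ^ k = 1 / 4 + (1 / 2) ^ k"
        by (simp add: q_2 power2_eq_square)
      \<comment> \<open>The bound \<open>t\<close> for \<open>\<mu> * g\<close> is kept apart from
        the bound \<open>d\<close> for \<open>g / E\<close>, since in the tightest case the former
        is strictly smaller.\<close>
      have num2: "(1 - t)\<^sup>2 \<le> (1 + 1 / (1 - t)) / (1 - u) * (2 * t + 2 * u * b / (a * (1 - d)))"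
        if "\<mu> \<le> u" "\<mu> * g \<le> t" "g / E \<le> d" "u < 1" "t < 1" "d < 1" "c \<le> b" "0 \<le> b"
          "0 < a" "a \<le> 1 / 4 + (1 / 2) ^ k" for t u a b d
      proof -
        have "\<mu> * c \<le> u * b"
          using mult_mono[OF that(1,7)] mult_left_mono[OF that(7), of \<mu>] mult_right_mono[OF that(1), of b] \<mu>0 that by linarith
        moreover have "a * (1 - d) \<le> h" using that by (intro h_ge) (auto simp: x_2)
        moreover have "0 < \<mu> * g" using \<mu>0 g0 by simp
        moreover have "0 < a * (1 - d)" using that by simp
        ultimately show ?thesis
          using \<rho> that \<mu>0 by (intro num) (auto simp: q_2 mult.assoc)
      qed
      \<comment> \<open>The factor \<open>1 / 4 + (1 / 2) ^ k\<close> in \<open>h\<close> is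
        replaced by 1/4 for \<open>k \<ge> 4\<close>; for \<open>k = 3\<close> and
        \<open>k = 2\<close> its values 3/8 and 1/2 are used.\<close>
      consider "4 \<le> k" | "k = 3" | "k = 2" "7 \<le> dimension" | "k = 2" "dimension = 6"
        using k n by linarith
      then show False
      proof cases
        case 1
        have k16: "(2::real) ^ 4 \<le> 2 ^ k" using 1 by (intro power_increasing) auto
        have "(2::real) ^ 4 * 2 ^ 4 \<le> 2 ^ k * 2 ^ k" using k16 by (intro mult_mono) auto
        then have E256: "256 \<le> E" using E_ge2 unfolding q_2 by simp
        have u: "\<mu> \<le> 1 / 256" using \<mu>_le E256 by (smt (verit) frac_le)
        have t: "g / E \<le> 1 / 16"
        proof -
          have "1 / q ^ k \<le> 1 / 16" using k16 unfolding q_2 by (intro divide_left_mono) auto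
          moreover have "g / E \<le> r" using gE_le by (simp add: q_2)
          ultimately show ?thesis using r by linarith
        qed
        have "g * g \<le> 2 ^ k * 2 ^ k" using g_2 g0 by (intro mult_mono) auto
        then have "g * g \<le> E" using E_ge2 by (simp add: q_2)
        then have "g * g * \<mu> \<le> E * \<mu>" using \<mu>0 by (intro mult_right_mono) auto
        then have "g * g * \<mu> \<le> 1" using \<mu>E by (simp add: mult.commute)
        then have "c \<le> 3 / 2" using c3 by fastforce
        from num2[OF u order_trans[OF \<mu>g_le t] t _ _ _ this, of "1 / 4"]
        show False by (simp add: power2_eq_square)
      next
        case 2
        have "(2::real) ^ 6 \<le> E" using 2 n unfolding E_def q_2 by (intro power_increasing) auto
        then have E: "64 \<le> E" by simp
        have g: "g = 7" using g_2 2 by simp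
        have u: "\<mu> \<le> 1 / 64" using \<mu>_le E by (smt (verit) frac_le)
        have t: "g / E \<le> 7 / 64" unfolding g using E by (intro divide_left_mono) auto
        \<comment> \<open>With \<open>g = 7\<close> the bound \<open>c2\<close> reads
          \<open>1 + 21 * \<mu>\<close>.\<close>
        have "c \<le> 85 / 64" using c2 u by (simp add: g)
        from num2[OF u order_trans[OF \<mu>g_le t] t _ _ _ this, of "3 / 8"]
        show False using 2 by (simp add: power2_eq_square power3_eq_cube)
      next
        case 3
        have "(2::real) ^ 5 \<le> E" using 3 unfolding E_def q_2 by (intro power_increasing) auto
        then have E: "32 \<le> E" by simp
        have g: "g = 3" using g_2 3 by simp
        have u: "\<mu> \<le> 1 / 32" using \<mu>_le E by (smt (verit) frac_le)
        have t: "g / E \<le> 3 / 32" unfolding g using E by (intro divide_left_mono) auto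
        have "c \<le> 35 / 32" using c2 u by (simp add: g)
        from num2[OF u order_trans[OF \<mu>g_le t] t _ _ _ this, of "1 / 2"]
        show False using 3 by (simp add: power2_eq_square)
      next
        case 4
        \<comment> \<open>the tightest case (\<open>0.8158\<close> against \<open>0.8007\<close>), where \<open>\<mu> \<le> 1 / E\<close> is too weak\<close>
        have E: "E = 16" using 4 by (simp add: E_def q_2)
        have g: "g = 3" using g_2 4 by simp
        have u: "\<mu> \<le> 1 / 31" using \<mu>_eq 4 by (simp add: q_2)
        have "c \<le> 34 / 31" using c2 u by (simp add: g)
        from num2[OF u _ _ _ _ _ this, of "3 / 31" "3 / 16" "1 / 2"] u
        show False using 4 by (simp add: power2_eq_square g E)
      qed
    qed
  qed
qed

section \<open>Gaussian coefficients and the existence of a star\<close>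

lemma ext_count_eq_gaussian_coeff:
  assumes "1 \<le> k" "k \<le> dimension"
  shows "ext_count k 0 1 = gaussian_coeff (card (UNIV :: 'a set)) (dimension - 1) (k - 1)"
proof -
  have "ext_count k 0 1 = (\<Prod>i=1..<k. (q ^ (dimension - i) - 1) / (q ^ (k - i) - 1))"
    unfolding ext_count_def using assms
  proof (simp, intro prod.cong refl)
    fix i assume i: "i \<in> {Suc 0..<k}"
    have "q ^ dimension - q ^ i = q ^ i * (q ^ (dimension - i) - 1)"
      and "q ^ k - q ^ i = q ^ i * (q ^ (k - i) - 1)"
      using i assms by (simp_all add: right_diff_distrib power_add[symmetric])
    then show "(br dimension - br i) / (br k - br i) = (q ^ (dimension - i) - 1) / (q ^ (k - i) - 1)"
      using q_ge_2 by (simp add: br_diff)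
  qed
  also have "\<dots> = (\<Prod>i=1..<k. q ^ (dimension - i) - 1) / (\<Prod>i=1..<k. q ^ (k - i) - 1)"
    by (rule prod_dividef)
  \<comment> \<open>Only the denominators have to be reversed; the numerators already have the order
    of the Gaussian coefficient.\<close>
  also have "(\<Prod>i=1..<k. q ^ (k - i) - 1) = (\<Prod>i=1..k - 1. q ^ i - 1)"
    by (rule prod.reindex_bij_witness[of _ "\<lambda>i. k - i" "\<lambda>i. k - i"]) auto
  also have "(\<Prod>i=1..<k. q ^ (dimension - i) - 1) = (\<Prod>i=1..k - 1. q ^ (dimension - 1 - i + 1) - 1)"
  proof (intro prod.cong)
    fix i assume "i \<in> {1..k - 1}"
    then have "dimension - i = dimension - 1 - i + 1" using assms by auto
    then show "q ^ (dimension - i) - 1 = q ^ (dimension - 1 - i + 1) - 1" by (simp only:)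
  qed (use assms in auto)
  also have "\<dots> / (\<Prod>i=1..k - 1. q ^ i - 1)
      = (\<Prod>i=1..k - 1. (q ^ (dimension - 1 - i + 1) - 1) / (q ^ i - 1))"
    by (rule prod_dividef[symmetric])
  finally show ?thesis using assms by (simp add: gaussian_coeff_def q_eq)
qed

text \<open>Dividing \<open>f\<close> by the largest weight of a \<open>k\<close>-space gives the
  normalisation of \<open>no_counterexample\<close> and preserves the signs of all weights. That
  largest weight is positive, since the weights sum to 0 and one of them is negative.\<close>

lemma star_exists:
  assumes f: "sum f (points UNIV) = 0" and k: "2 * k < dimension" "2 \<le> k"
    and few: "real (card (nonneg_subspaces scale f k)) \<le> ext_count k 0 1"
    and large: "q \<ge> 32 \<or> 3 * k \<le> dimension"
  shows "\<exists>P\<in>points UNIV. {T \<in> subspaces_of_dim scale k. P \<subseteq> T} \<subseteq> nonneg_subspaces scale f k"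
proof (rule ccontr)
  assume no_star: "\<not> ?thesis"
  let ?G = "subspaces_of_dim scale k" and ?w = "weight scale f"
  have neg: "\<exists>U\<in>?G. P \<subseteq> U \<and> ?w U < 0" if "P \<in> points UNIV" for P
    using no_star that by (fastforce simp: nonneg_subspaces_def)
  have "br 0 < br dimension" using k by (intro br_strict_mono) auto
  then have "points UNIV \<noteq> {}" using card_points[OF subspace_UNIV] by (auto simp: dimension_def)
  then obtain U where U: "U \<in> ?G" "?w U < 0" using neg by blast
  then have "Max (?w ` ?G) \<in> ?w ` ?G" by (intro Max_in) auto
  then obtain S where "S \<in> ?G" "?w S = Max (?w ` ?G)" by auto
  then have S: "S \<in> ?G" "\<And>T. T \<in> ?G \<Longrightarrow> ?w T \<le> ?w S" by (auto intro: Max_ge)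
  have pos: "0 < ?w S"
  proof (rule ccontr)
    assume "\<not> 0 < ?w S"
    then have "0 \<le> - ?w T" if "T \<in> ?G" for T using S(2)[OF that] by simp
    then have "- ?w U \<le> (\<Sum>T\<in>?G. - ?w T)" using U by (intro member_le_sum) auto
    then show False using U sum_weight_all[OF f, of k] by (simp add: sum_negf)
  qed
  define g where "g P = f P / ?w S" for P
  have w: "weight scale g T = ?w T / ?w S" for T
    by (simp add: weight_eq g_def sum_divide_distrib)
  have Y: "nonneg_subspaces scale g k = nonneg_subspaces scale f k"
    using pos by (auto simp: nonneg_subspaces_def w zero_le_divide_iff)
  show False
  proof (rule no_counterexample[where f = g and S = S])
    show "sum g (points UNIV) = 0" using f by (simp add: g_def sum_divide_distrib[symmetric])
    show "\<exists>U\<in>?G. P \<subseteq> U \<and> weight scale g U < 0" if "P \<in> points UNIV" for P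
      using neg[OF that] pos by (auto simp: w divide_less_0_iff)
  qed (use k few large S pos in \<open>auto simp: Y w\<close>)
qed

end

theorem theorem1p3:
  fixes scale :: "'a::{field, finite} \<Rightarrow> 'b::ab_group_add \<Rightarrow> 'b"
    and Basis :: "'b set"
    and f :: "'b set \<Rightarrow> real"
    and n k x q :: nat
  assumes V: "finite_dimensional_vector_space scale Basis"
    and n: "vector_space.dim scale (UNIV :: 'b set) = n"
    and q: "q = card (UNIV :: 'a set)"
    and f: "(\<Sum>P\<in>subspaces_of_dim scale 1. f P) = 0"
    and x: "2 \<le> x" "x \<le> k"
    and cond:
      "((int x - 1) * int n \<ge> (2 * int x - 1) * int k - int x + 2
          \<and> n \<ge> 2 * k + 2 \<and> q \<ge> fact (x - 1) * 2 ^ (x + 2))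
       \<or> ((int x - 1) * int n \<ge> (2 * int x - 1) * int k - int x + 1
          \<and> n \<ge> 2 * k + 1 \<and> q \<ge> fact (x - 1) * 2 ^ (2 * x + 1))
       \<or> ((n \<ge> 3 * k \<and> q \<ge> 2) \<or> (n = k \<and> q \<ge> 2))"
  shows "real (card (nonneg_subspaces scale f k)) \<ge> gaussian_coeff q (n - 1) (k - 1)
    \<and> (real (card (nonneg_subspaces scale f k)) = gaussian_coeff q (n - 1) (k - 1)
          \<and> n \<ge> 2 * k + 1
        \<longrightarrow> (\<exists>P \<in> subspaces_of_dim scale 1.
              nonneg_subspaces scale f k
                = {S \<in> subspaces_of_dim scale k. P \<subseteq> S}))"
proof -
  interpret finite_field_vector_space scale Basis "real q"
    using V q by (simp add: finite_field_vector_space_def finite_field_vector_space_axioms_def)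
  let ?Y = "nonneg_subspaces scale f k" and ?M = "ext_count k 0 1"
  have dim_n: "dimension = n" using n by (simp add: dimension_def)
  have points: "points UNIV = subspaces_of_dim scale 1" by (simp add: points_def)
  have f0: "sum f (points UNIV) = 0" using f by (simp add: points)
  have k2: "2 \<le> k" using x by simp
  have "k \<le> n" using cond by auto
  then have M: "gaussian_coeff q (n - 1) (k - 1) = ?M"
    using ext_count_eq_gaussian_coeff[of k] k2 by (simp add: dim_n q)
  show ?thesis
  \<comment> \<open>For \<open>n = k\<close> the only \<open>k\<close>-space is the whole space, of
    weight 0, and every factor of \<open>?M\<close> is 1.\<close>
  proof (cases "n = k")
    case True
    have "T = UNIV" if "T \<in> subspaces_of_dim scale k" for T
      using subspaces_of_dimD[OF that] n True
      by (intro subspace_dim_equal) auto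
    moreover have "UNIV \<in> ?Y"
      using n True f by (simp add: nonneg_subspaces_def subspaces_of_dim_def weight_def)
    ultimately have "?Y = {UNIV}" by (auto simp: nonneg_subspaces_def)
    moreover have "(\<Prod>i=1..<k. (br dimension - br (0 + i)) / (br k - br i)) = 1"
      by (intro prod.neutral) (use br_strict_mono[of _ k] True in \<open>force simp: dim_n\<close>)
    then have "?M = 1" using k2 by (simp add: ext_count_def)
    ultimately show ?thesis using M True k2 by simp
  next
    case False
    have pow: "32 \<le> a * 2 ^ e" if "1 \<le> a" "5 \<le> e" for a e :: nat
      using mult_mono[OF that(1) power_increasing[OF that(2), of 2]] by simp
    \<comment> \<open>For \<open>x = 2\<close> the first alternative gives only
      \<open>q \<ge> 16\<close>, but its inequality then reads \<open>n \<ge> 3 * k\<close>. For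
      \<open>x \<ge> 3\<close>, and in the second alternative for every \<open>x\<close>, the
      exponent of 2 is at least 5.\<close>
    have large: "32 \<le> q \<and> 2 * k < n \<or> 3 * k \<le> n"
      using cond
    proof (elim disjE)
      assume a: "(int x - 1) * int n \<ge> (2 * int x - 1) * int k - int x + 2
        \<and> n \<ge> 2 * k + 2 \<and> q \<ge> fact (x - 1) * 2 ^ (x + 2)"
      show ?thesis
      proof (cases "x = 2")
        case True
        then show ?thesis using a by simp
      next
        case False
        then show ?thesis using a x pow[of "fact (x - 1)" "x + 2"] by simp
      qed
    next
      assume "(int x - 1) * int n \<ge> (2 * int x - 1) * int k - int x + 1
        \<and> n \<ge> 2 * k + 1 \<and> q \<ge> fact (x - 1) * 2 ^ (2 * x + 1)"
      then show ?thesis using x pow[of "fact (x - 1)" "2 * x + 1"] by simp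
    qed (use False in auto)
    then have kn: "2 * k < n" using k2 by auto
    \<comment> \<open>Assuming only at most \<open>?M\<close> nonnegative spaces, this both excludes
      a smaller number and settles equality: the star found has \<open>?M\<close> elements and
      therefore fills \<open>?Y\<close>.\<close>
    have star: "\<exists>P\<in>subspaces_of_dim scale 1. ?Y = {S \<in> subspaces_of_dim scale k. P \<subseteq> S} \<and> real (card ?Y) = ?M"
      if few: "real (card ?Y) \<le> ?M"
    proof -
      obtain P where P: "P \<in> points UNIV" "{T \<in> subspaces_of_dim scale k. P \<subseteq> T} \<subseteq> ?Y"
        using star_exists[OF f0 _ k2 few] large kn by (auto simp: dim_n)
      have "real (card {T \<in> subspaces_of_dim scale k. P \<subseteq> T}) = ?M"
        using card_extensions[of P k] subspaces_of_dimD[of P 1] P(1) by (simp add: points)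
      then have "card ?Y \<le> card {T \<in> subspaces_of_dim scale k. P \<subseteq> T}" using few by linarith
      then have "{T \<in> subspaces_of_dim scale k. P \<subseteq> T} = ?Y"
        using P(2) by (intro card_seteq) auto
      then show ?thesis
        using P(1) \<open>real (card {T \<in> subspaces_of_dim scale k. P \<subseteq> T}) = ?M\<close> by (auto simp: points)
    qed
    have "?M \<le> real (card ?Y)"
    proof (rule ccontr)
      assume "\<not> ?M \<le> real (card ?Y)"
      then show False using star by auto
    qed
    then show ?thesis using star M by auto
  qed
qed

end
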